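(* Let $\Psi$ be a growth function of order $p$ with $p\in(d/(d+1),1]$. (1) There exist positive constants $a_d$ and $B_{d,\Psi,p}$ such that for any Schwartz function $f$ on $\mathbb{R}^d$ $$\|f\|_{L^\infty(\mathbb{R}^d)}\le B_{d,\Psi,p}\,\big\|\Psi^{-1}\big(a_d(-\Delta)^{d/2}\big)f\big\|_{H^\Psi(\mathbb{R}^d)}.$$ (2) There exist positive constants $a_d$ and $C_{d,\Psi,p}$ such that for any Schwartz function $f$ on $\mathbb{R}^d$ $$\|f\|_{L^\infty(\mathbb{R}^d)}\le C_{d,\Psi,p}\,\big\|\Psi^{-1}\big(a_d(1-\Delta)^{d/2}\big)f\big\|_{h^\Psi(\mathbb{R}^d)}.$$
   Context: Growth function of order $p\in(0,1]$: a function $\Psi:[0,\infty)\to[0,\infty)$ that is continuous and (strictly) increasing with $\Psi(0)=0$, $\lim_{t\to\infty}\Psi(t)=\infty$, such that $t\mapsto t^{-1}\Psi(t)$ is non-increasing on $(0,\infty)$, and of lower type $p$: there is $c>0$ with $\Psi(st)\le c\,s^p\,\Psi(t)$ for all $t\ge0$, $s\in(0,1)$. $\Psi^{-1}$ is its inverse function. $\Psi^{-1}(a_d(-\Delta)^{d/2})$ and $\Psi^{-1}(a_d(1-\Delta)^{d/2})$ are the Fourier multiplier operators with symbols $\Psi^{-1}(a_d|\xi|^d)$ and $\Psi^{-1}(a_d(1+|\xi|^2)^{d/2})$, where the operator with symbol $\sigma$ is $\sigma(D)f(x)=(2\pi)^{-d}\int\sigma(\xi)\widehat f(\xi)e^{ix\cdot\xi}\,d\xi$,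 $\widehat f(\xi)=\int f(x)e^{-ix\cdot\xi}\,dx$. Let $m_\Psi=\lfloor d(1/i_\Psi-1)\rfloor$, where $i_\Psi=\sup\{p\in(0,1]:\Psi\text{ is of lower type }p\}$; let $\mathcal{F}_{m_\Psi}$ be the set of $\phi\in\mathcal{S}(\mathbb{R}^d)$ with $\sup_{x}\sup_{|\beta|\le m_\Psi+1}(1+|x|)^{(m_\Psi+2)(d+1)}|\partial^\beta\phi(x)|\le1$, and $\phi_t(x)=t^{-d}\phi(x/t)$. For a tempered distribution $g$ put $$M^*[g](x)=\sup_{\phi\in\mathcal{F}_{m_\Psi}}\sup_{t>0,\,|x-y|<t}|g*\phi_t(y)|,\qquad M^*_{\rm loc}[g](x)=\sup_{\phi\in\mathcal{F}_{m_\Psi}}\sup_{0<t<1,\,|x-y|<t}|g*\phi_t(y)|.$$ $H^\Psi(\mathbb{R}^d)$ (resp. $h^\Psi(\mathbb{R}^d)$) is the class of tempered distributions $g$ with $\int\Psi(M^*[g])<\infty$ (resp. $\int\Psi(M^*_{\rm loc}[g])<\infty$), with $\|g\|=\inf\{\lambda>0:\int\Psi(\lambda^{-1}M[g](x))\,dx\le1\}$, where $M=M^*$ (resp. $M=M^*_{\rm loc}$); the norm is $+\infty$ if $g$ is not in the space. *)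

theory Defs
  imports "HOL-Analysis.Analysis" "HOL-Probability.Essential_Supremum"
begin

text \<open>Growth functions are total functions of which only the restriction to \<open>[0,\<infinity>)\<close> is used.\<close>

definition lower_type :: "real \<Rightarrow> (real \<Rightarrow> real) \<Rightarrow> bool" where
  "lower_type p \<Psi> \<longleftrightarrow>
    (\<exists>c>0. \<forall>t\<ge>0. \<forall>s\<in>{0<..<1}. \<Psi> (s * t) \<le> c * s powr p * \<Psi> t)"

definition growth_function :: "real \<Rightarrow> (real \<Rightarrow> real) \<Rightarrow> bool" where
  "growth_function p \<Psi> \<longleftrightarrow>
    0 < p \<and> p \<le> 1 \<and>
    \<Psi> ` {0..} \<subseteq> {0..} \<and>
    continuous_on {0..} \<Psi> \<and> strict_mono_on {0..} \<Psi> \<and>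
    \<Psi> 0 = 0 \<and> filterlim \<Psi> at_top at_top \<and>
    antimono_on {0<..} (\<lambda>t. \<Psi> t / t) \<and>
    lower_type p \<Psi>"

definition growth_inv :: "(real \<Rightarrow> real) \<Rightarrow> real \<Rightarrow> real" where
  "growth_inv \<Psi> = inv_into {0..} \<Psi>"

definition lower_index :: "(real \<Rightarrow> real) \<Rightarrow> real" where
  "lower_index \<Psi> = Sup {p. 0 < p \<and> p \<le> 1 \<and> lower_type p \<Psi>}"

definition moment_order :: "nat \<Rightarrow> (real \<Rightarrow> real) \<Rightarrow> nat" where
  "moment_order d \<Psi> = nat \<lfloor>real d * (1 / lower_index \<Psi> - 1)\<rfloor>"

text \<open>
  A partial derivative \<open>\<partial>\<^sup>\<beta>\<close> is encoded by a list of basis vectors, one entry for each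
  differentiation, so that \<open>|\<beta>|\<close> is the length of the list. Mixed partial derivatives of smooth
  functions commute, hence only the multiplicities in the list matter.
\<close>

fun partial_deriv :: "'a::euclidean_space list \<Rightarrow> ('a \<Rightarrow> complex) \<Rightarrow> 'a \<Rightarrow> complex" where
  "partial_deriv [] f = f"
| "partial_deriv (b # bs) f = (\<lambda>x. frechet_derivative (partial_deriv bs f) (at x) b)"

definition multi_indices :: "nat \<Rightarrow> 'a::euclidean_space list set" where
  "multi_indices k = {bs. set bs \<subseteq> Basis \<and> length bs \<le> k}"

definition smooth :: "('a::euclidean_space \<Rightarrow> complex) \<Rightarrow> bool" where
  "smooth f \<longleftrightarrow> (\<forall>bs. set bs \<subseteq> Basis \<longrightarrow> partial_deriv bs f differentiable_on UNIV)"

definition schwartz :: "('a::euclidean_space \<Rightarrow> complex) set" where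
  "schwartz = {f. smooth f \<and>
    (\<forall>N. \<forall>bs. set bs \<subseteq> Basis \<longrightarrow>
      (\<exists>C. \<forall>x. (1 + norm x) ^ N * cmod (partial_deriv bs f x) \<le> C))}"

definition schwartz_seminorm :: "nat \<Rightarrow> ('a::euclidean_space \<Rightarrow> complex) \<Rightarrow> real" where
  "schwartz_seminorm N f =
    (SUP bs\<in>multi_indices N. SUP x. (1 + norm x) ^ N * cmod (partial_deriv bs f x))"

text \<open>
  Tempered distributions are linear functionals on Schwartz functions, continuous for the topology
  generated by the seminorms above. These seminorms increase with \<open>N\<close>, so continuity means
  domination by a multiple of one of them. Values at functions that are not Schwartz are irrelevant.
\<close>

definition tempered_distribution :: "(('a::euclidean_space \<Rightarrow> complex) \<Rightarrow> complex) \<Rightarrow> bool" where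
  "tempered_distribution g \<longleftrightarrow>
    (\<forall>\<phi>\<in>schwartz. \<forall>\<psi>\<in>schwartz. g (\<lambda>x. \<phi> x + \<psi> x) = g \<phi> + g \<psi>) \<and>
    (\<forall>c. \<forall>\<phi>\<in>schwartz. g (\<lambda>x. c * \<phi> x) = c * g \<phi>) \<and>
    (\<exists>C N. \<forall>\<phi>\<in>schwartz. cmod (g \<phi>) \<le> C * schwartz_seminorm N \<phi>)"

definition distr_of_fun :: "('a::euclidean_space \<Rightarrow> complex) \<Rightarrow> ('a \<Rightarrow> complex) \<Rightarrow> complex" where
  "distr_of_fun h \<phi> = (LINT x|lborel. h x * \<phi> x)"

definition distr_conv ::
  "(('a::euclidean_space \<Rightarrow> complex) \<Rightarrow> complex) \<Rightarrow> ('a \<Rightarrow> complex) \<Rightarrow> 'a \<Rightarrow> complex" where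
  "distr_conv g \<phi> y = g (\<lambda>z. \<phi> (y - z))"

definition fourier :: "('a::euclidean_space \<Rightarrow> complex) \<Rightarrow> 'a \<Rightarrow> complex" where
  "fourier f \<xi> = (LINT x|lborel. f x * exp (- (\<i> * of_real (x \<bullet> \<xi>))))"

definition fourier_multiplier ::
  "('a::euclidean_space \<Rightarrow> real) \<Rightarrow> ('a \<Rightarrow> complex) \<Rightarrow> 'a \<Rightarrow> complex" where
  "fourier_multiplier \<sigma> f x =
    of_real (1 / (2 * pi) ^ DIM('a)) *
    (LINT \<xi>|lborel. of_real (\<sigma> \<xi>) * fourier f \<xi> * exp (\<i> * of_real (x \<bullet> \<xi>)))"

text \<open>
  Since \<open>-\<Delta>\<close> has symbol \<open>|\<xi>|\<^sup>2\<close>, these are \<open>\<Psi>\<^sup>-\<^sup>1(a(-\<Delta>)\<^sup>d\<^sup>/\<^sup>2)\<close> and \<open>\<Psi>\<^sup>-\<^sup>1(a(1-\<Delta>)\<^sup>d\<^sup>/\<^sup>2)\<close>.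
\<close>

definition riesz_operator ::
  "(real \<Rightarrow> real) \<Rightarrow> real \<Rightarrow> ('a::euclidean_space \<Rightarrow> complex) \<Rightarrow> 'a \<Rightarrow> complex" where
  "riesz_operator \<Psi> a =
    fourier_multiplier (\<lambda>\<xi>. growth_inv \<Psi> (a * norm \<xi> ^ DIM('a)))"

definition bessel_operator ::
  "(real \<Rightarrow> real) \<Rightarrow> real \<Rightarrow> ('a::euclidean_space \<Rightarrow> complex) \<Rightarrow> 'a \<Rightarrow> complex" where
  "bessel_operator \<Psi> a =
    fourier_multiplier (\<lambda>\<xi>. growth_inv \<Psi> (a * (1 + (norm \<xi>)\<^sup>2) powr (real DIM('a) / 2)))"

definition test_class :: "nat \<Rightarrow> ('a::euclidean_space \<Rightarrow> complex) set" where
  "test_class m = {\<phi> \<in> schwartz. \<forall>x. \<forall>bs\<in>multi_indices (m + 1).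
      (1 + norm x) ^ ((m + 2) * (DIM('a) + 1)) * cmod (partial_deriv bs \<phi> x) \<le> 1}"

definition dilate :: "real \<Rightarrow> ('a::euclidean_space \<Rightarrow> complex) \<Rightarrow> 'a \<Rightarrow> complex" where
  "dilate t \<phi> x = of_real (1 / t ^ DIM('a)) * \<phi> (x /\<^sub>R t)"

definition maximal_fun ::
  "real set \<Rightarrow> nat \<Rightarrow> (('a::euclidean_space \<Rightarrow> complex) \<Rightarrow> complex) \<Rightarrow> 'a \<Rightarrow> ennreal" where
  "maximal_fun scales m g x =
    (SUP \<phi>\<in>test_class m. SUP t\<in>scales. SUP y\<in>ball x t. ennreal (cmod (distr_conv g (dilate t \<phi>) y)))"

definition grand_maximal ::
  "(real \<Rightarrow> real) \<Rightarrow> (('a::euclidean_space \<Rightarrow> complex) \<Rightarrow> complex) \<Rightarrow> 'a \<Rightarrow> ennreal" where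
  "grand_maximal \<Psi> = maximal_fun {0<..} (moment_order DIM('a) \<Psi>)"

definition local_grand_maximal ::
  "(real \<Rightarrow> real) \<Rightarrow> (('a::euclidean_space \<Rightarrow> complex) \<Rightarrow> complex) \<Rightarrow> 'a \<Rightarrow> ennreal" where
  "local_grand_maximal \<Psi> = maximal_fun {0<..<1} (moment_order DIM('a) \<Psi>)"

text \<open>Maximal functions may take the value \<open>\<infinity>\<close>, so \<open>\<Psi>\<close> is extended by \<open>\<Psi>(\<infinity>) = \<infinity>\<close>.\<close>

definition extend_ennreal :: "(real \<Rightarrow> real) \<Rightarrow> ennreal \<Rightarrow> ennreal" where
  "extend_ennreal \<Psi> u = (if u = \<infinity> then \<infinity> else ennreal (\<Psi> (enn2real u)))"

definition modular :: "(real \<Rightarrow> real) \<Rightarrow> ('a::euclidean_space \<Rightarrow> ennreal) \<Rightarrow> ennreal" where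
  "modular \<Psi> F = (\<integral>\<^sup>+ x. extend_ennreal \<Psi> (F x) \<partial>lborel)"

definition luxemburg :: "(real \<Rightarrow> real) \<Rightarrow> ('a::euclidean_space \<Rightarrow> ennreal) \<Rightarrow> ennreal" where
  "luxemburg \<Psi> F =
    (INF l\<in>{l. 0 < l \<and> modular \<Psi> (\<lambda>x. ennreal (inverse l) * F x) \<le> 1}. ennreal l)"

definition hardy_orlicz ::
  "(real \<Rightarrow> real) \<Rightarrow> (('a::euclidean_space \<Rightarrow> complex) \<Rightarrow> complex) set" where
  "hardy_orlicz \<Psi> = {g. tempered_distribution g \<and> modular \<Psi> (grand_maximal \<Psi> g) < \<infinity>}"

definition local_hardy_orlicz ::
  "(real \<Rightarrow> real) \<Rightarrow> (('a::euclidean_space \<Rightarrow> complex) \<Rightarrow> complex) set" where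
  "local_hardy_orlicz \<Psi> =
    {g. tempered_distribution g \<and> modular \<Psi> (local_grand_maximal \<Psi> g) < \<infinity>}"

definition hardy_orlicz_norm ::
  "(real \<Rightarrow> real) \<Rightarrow> (('a::euclidean_space \<Rightarrow> complex) \<Rightarrow> complex) \<Rightarrow> ennreal" where
  "hardy_orlicz_norm \<Psi> g =
    (if g \<in> hardy_orlicz \<Psi> then luxemburg \<Psi> (grand_maximal \<Psi> g) else \<infinity>)"

definition local_hardy_orlicz_norm ::
  "(real \<Rightarrow> real) \<Rightarrow> (('a::euclidean_space \<Rightarrow> complex) \<Rightarrow> complex) \<Rightarrow> ennreal" where
  "local_hardy_orlicz_norm \<Psi> g =
    (if g \<in> local_hardy_orlicz \<Psi> then luxemburg \<Psi> (local_grand_maximal \<Psi> g) else \<infinity>)"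

definition Linf_norm :: "('a::euclidean_space \<Rightarrow> complex) \<Rightarrow> ennreal" where
  "Linf_norm f = esssup lborel (\<lambda>x. ennreal (cmod (f x)))"

end

theory Submission
  imports Defs "HOL-Probability.Probability"
begin

text \<open>
  Write \<open>d\<close> for the dimension, \<open>v\<close> for the volume of the unit ball, \<open>\<sigma>\<close> for the symbol of the operator,
  \<open>h = \<sigma> f^\<close> for the Fourier transform of \<open>g = \<sigma>(D)f\<close>, and \<open>W = M[g] / l\<close> for a number \<open>l\<close> with
  \<open>\<integral> \<Psi>(W) \<le> 1\<close>. Inversion bounds \<open>(2\<pi>)\<^sup>d |f(x)|\<close> by \<open>\<integral> |f^|\<close>, so the theorem is a Hardy
  inequality: \<open>\<integral> |h| / \<sigma>\<close> has to be bounded by a multiple of \<open>l\<close>. The symbol is merely continuous, so its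
  inverse has no kernel with usable decay; the argument therefore uses only sizes on the frequency side.

  Cut frequency space into shells \<open>|\<xi>| ~ 2\<^sup>j\<close> and let \<open>G\<^sub>j\<close> be the convolution of \<open>g\<close> with a Gaussian of width
  \<open>2\<^sup>-\<^sup>j\<close>. Its multiplier is bounded below on the shell, so Cauchy--Schwarz and Plancherel give
  \<open>\<integral>\<^bsub>shell j\<^esub> |h| \<le> C 2\<^sup>j\<^sup>d\<^sup>/\<^sup>2 \<parallel>G\<^sub>j\<parallel>\<^sub>2\<close> (lemma \<open>nn_integral_low_frequency_le\<close>).
  The Gaussian is a multiple of a test function, so \<open>|G\<^sub>j(y)| \<le> C l W(x)\<close> whenever \<open>|x - y| < 2\<^sup>-\<^sup>j\<close>.
  This says more than \<open>|G\<^sub>j| \<le> C l W\<close>: a value above \<open>2\<^sup>n\<close> (after normalisation) forces the superlevel set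
  \<open>E\<^sub>n = {W > 2\<^sup>n}\<close> to contain a ball of radius \<open>2\<^sup>-\<^sup>j\<close>. Hence only the levels \<open>n\<close> with \<open>|E\<^sub>n| \<ge> v 2\<^sup>-\<^sup>j\<^sup>d\<close>
  contribute to \<open>\<parallel>G\<^sub>j\<parallel>\<^sub>2\<close>, and
  \<open>\<parallel>G\<^sub>j\<parallel>\<^sub>2 \<le> C l \<Sum>\<^sub>n 2\<^sup>n |E\<^sub>n|\<^sup>1\<^sup>/\<^sup>2\<close> over these \<open>n\<close> (lemma \<open>nn_integral_power2_le_level_sum\<close>).

  On the shell \<open>\<sigma>\<close> is at least \<open>\<Psi>\<^sup>-\<^sup>1(2\<^sup>j\<^sup>d / v)\<close>; the constant \<open>a = 2\<^sup>d / v\<close> is chosen for that. For a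
  contributing level, Chebyshev's inequality gives \<open>\<Psi>(2\<^sup>n) \<le> 1 / |E\<^sub>n| \<le> 2\<^sup>j\<^sup>d / v\<close>, and since \<open>\<Psi>(t) / t\<close> is
  non-increasing this turns \<open>1 / \<Psi>\<^sup>-\<^sup>1(2\<^sup>j\<^sup>d / v)\<close> into at most \<open>v 2\<^sup>-\<^sup>j\<^sup>d \<Psi>(2\<^sup>n) / 2\<^sup>n\<close>. What remains is
  \<open>\<Sum>\<^sub>n \<Psi>(2\<^sup>n) |E\<^sub>n|\<^sup>1\<^sup>/\<^sup>2 \<Sum>\<^sub>j 2\<^sup>-\<^sup>j\<^sup>d\<^sup>/\<^sup>2\<close> over \<open>v 2\<^sup>-\<^sup>j\<^sup>d \<le> |E\<^sub>n|\<close>. The inner sum is geometric and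
  comparable to \<open>|E\<^sub>n|\<^sup>1\<^sup>/\<^sup>2\<close>, and \<open>\<Sum>\<^sub>n \<Psi>(2\<^sup>n) |E\<^sub>n| \<le> C \<integral> \<Psi>(W)\<close> because \<open>\<Psi>\<close> is of positive
  lower type (lemma \<open>hardy_sum_le\<close>). The two halves of the theorem differ only in the shells: for the
  inhomogeneous operator all frequencies \<open>|\<xi>| \<le> 2\<close> form one piece, treated at the scale \<open>1/2\<close>, so only
  scales below \<open>1\<close> occur (lemma \<open>multiplier_sup_bound\<close> covers both).
\<close>

section \<open>Growth functions and dyadic sums\<close>

lemma growth_function_nonneg: "growth_function p \<Psi> \<Longrightarrow> 0 \<le> t \<Longrightarrow> 0 \<le> \<Psi> t"
  by (auto simp: growth_function_def)

lemma growth_function_less_iff: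
  "growth_function p \<Psi> \<Longrightarrow> 0 \<le> s \<Longrightarrow> 0 \<le> t \<Longrightarrow> \<Psi> s < \<Psi> t \<longleftrightarrow> s < t"
  using strict_mono_on_less[of "{0..}" \<Psi> s t] by (simp add: growth_function_def)

lemma growth_function_le_iff:
  "growth_function p \<Psi> \<Longrightarrow> 0 \<le> s \<Longrightarrow> 0 \<le> t \<Longrightarrow> \<Psi> s \<le> \<Psi> t \<longleftrightarrow> s \<le> t"
  by (meson growth_function_less_iff not_le)

lemma growth_function_pos: "growth_function p \<Psi> \<Longrightarrow> 0 < t \<Longrightarrow> 0 < \<Psi> t"
  using growth_function_less_iff[of p \<Psi> 0 t] by (simp add: growth_function_def)

lemma growth_function_inj: "growth_function p \<Psi> \<Longrightarrow> inj_on \<Psi> {0..}"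
  unfolding growth_function_def by (blast intro: strict_mono_on_imp_inj_on)

lemma growth_function_image:
  assumes "growth_function p \<Psi>"
  shows "\<Psi> ` {0..} = {0..}"
proof
  show "\<Psi> ` {0..} \<subseteq> {0..}" using assms by (auto simp: growth_function_def)
next
  show "{0..} \<subseteq> \<Psi> ` {0..}"
  proof
    fix y :: real assume y: "y \<in> {0..}"
    have "eventually (\<lambda>t. y \<le> \<Psi> t) at_top"
      using assms unfolding growth_function_def filterlim_at_top by blast
    then obtain N where N: "\<And>t. t \<ge> N \<Longrightarrow> y \<le> \<Psi> t"
      unfolding eventually_at_top_linorder by blast
    have "\<exists>x. 0 \<le> x \<and> x \<le> max N 0 \<and> \<Psi> x = y"
    proof (rule IVT')
      show "\<Psi> 0 \<le> y" using y assms by (simp add: growth_function_def)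
      show "continuous_on {0..max N 0} \<Psi>"
        using assms continuous_on_subset unfolding growth_function_def by fastforce
    qed (use N[of "max N 0"] in auto)
    then show "y \<in> \<Psi> ` {0..}" by auto
  qed
qed

lemma growth_inv_nonneg: "growth_function p \<Psi> \<Longrightarrow> 0 \<le> r \<Longrightarrow> 0 \<le> growth_inv \<Psi> r"
  using inv_into_into[of r \<Psi> "{0..}"] growth_function_image[of p \<Psi>]
  by (auto simp: growth_inv_def)

lemma growth_function_growth_inv: "growth_function p \<Psi> \<Longrightarrow> 0 \<le> r \<Longrightarrow> \<Psi> (growth_inv \<Psi> r) = r"
  using f_inv_into_f[of r \<Psi> "{0..}"] growth_function_image[of p \<Psi>]
  by (auto simp: growth_inv_def)

lemma le_growth_inv_iff:
  "growth_function p \<Psi> \<Longrightarrow> 0 \<le> t \<Longrightarrow> 0 \<le> r \<Longrightarrow> t \<le> growth_inv \<Psi> r \<longleftrightarrow> \<Psi> t \<le> r"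
  by (metis growth_function_growth_inv growth_function_le_iff growth_inv_nonneg)

lemma growth_inv_pos: "growth_function p \<Psi> \<Longrightarrow> 0 < r \<Longrightarrow> 0 < growth_inv \<Psi> r"
  by (metis growth_function_def growth_function_growth_inv growth_inv_nonneg less_le)

lemma growth_inv_mono:
  "growth_function p \<Psi> \<Longrightarrow> 0 \<le> r \<Longrightarrow> r \<le> s \<Longrightarrow> growth_inv \<Psi> r \<le> growth_inv \<Psi> s"
  using le_growth_inv_iff[of p \<Psi> "growth_inv \<Psi> r" s] growth_function_growth_inv[of p \<Psi> r]
    growth_inv_nonneg[of p \<Psi> r] by simp

text \<open>
  Makes the symbols of both operators continuous, and with them the functions to which the pointwise
  limit arguments for Fourier integrals are applied.
\<close>

lemma continuous_on_growth_inv: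
  assumes "growth_function p \<Psi>"
  shows "continuous_on {0..} (growth_inv \<Psi>)"
proof -
  have "\<exists>g. homeomorphism {0..} {0..} \<Psi> g"
    using assms growth_function_image[OF assms] growth_function_inj[OF assms]
    by (intro homeomorphism_into_1d convex_imp_path_connected) (auto simp: growth_function_def)
  then obtain g where g: "homeomorphism {0..} {0..} \<Psi> g" ..
  have "growth_inv \<Psi> r = g r" if "r \<in> {0..}" for r
  proof -
    have "r = \<Psi> (g r)" "g r \<in> {0..}" using g that unfolding homeomorphism_def by auto
    then show ?thesis
      using inv_into_f_f[OF growth_function_inj[OF assms], of "g r"] by (simp add: growth_inv_def)
  qed
  then show ?thesis
    using g continuous_on_cong[of "{0..}" "{0..}" "growth_inv \<Psi>" g] unfolding homeomorphism_def by blast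
qed

text \<open>
  Lower type, read from \<open>1\<close> upwards, says that \<open>\<Psi>(t)\<close> is at least a multiple of \<open>t\<^sup>p\<close>, so the inverse
  grows at most like \<open>r\<^sup>1\<^sup>/\<^sup>p\<close>. This is what makes a symbol times a rapidly decaying function integrable.
\<close>

lemma growth_inv_polynomial_bound:
  assumes "growth_function p \<Psi>"
  shows "\<exists>c\<ge>0. \<exists>N. \<forall>r\<ge>0. growth_inv \<Psi> r \<le> (1 + c * r) ^ N"
proof -
  obtain c where c: "c > 0" "\<And>t s. 0 \<le> t \<Longrightarrow> 0 < s \<Longrightarrow> s < 1 \<Longrightarrow> \<Psi> (s * t) \<le> c * s powr p * \<Psi> t"
    using assms unfolding growth_function_def lower_type_def by auto
  have p: "0 < p" using assms by (simp add: growth_function_def)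
  define q where "q = \<Psi> 1"
  have q: "q > 0" using growth_function_pos[OF assms, of 1] by (simp add: q_def)
  define N where "N = nat \<lceil>1 / p\<rceil>"
  have N: "1 / p \<le> real N" unfolding N_def by linarith
  have "growth_inv \<Psi> r \<le> (1 + (c / q) * r) ^ N" if r: "r \<ge> 0" for r
  proof (cases "growth_inv \<Psi> r \<le> 1")
    case True
    moreover have "0 \<le> (c / q) * r" using c q r by simp
    ultimately show ?thesis using one_le_power[of "1 + (c / q) * r" N] by linarith
  next
    case False
    define t where "t = growth_inv \<Psi> r"
    have t: "t > 1" "\<Psi> t = r" using False growth_function_growth_inv[OF assms r] by (auto simp: t_def)
    have "q \<le> c * (1 / t) powr p * r" using c(2)[of t "1 / t"] t by (simp add: q_def)
    then have "q * t powr p \<le> c * r" using t by (simp add: powr_divide field_simps)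
    then have "t powr p \<le> (c / q) * r" using q by (simp add: field_simps)
    then have *: "t powr p \<le> 1 + (c / q) * r" by linarith
    have "t = (t powr p) powr (1 / p)" using p t by (simp add: powr_powr)
    also have "\<dots> \<le> (1 + (c / q) * r) powr (1 / p)"
      using * p by (intro powr_mono2) auto
    also have "\<dots> \<le> (1 + (c / q) * r) powr real N"
      using N c q r by (intro powr_mono) auto
    also have "\<dots> = (1 + (c / q) * r) ^ N"
      using c q r by (intro powr_realpow) (auto intro!: add_pos_nonneg)
    finally show ?thesis by (simp add: t_def)
  qed
  then show ?thesis using c q by (intro exI[of _ "c / q"]) auto
qed

text \<open>
  The quotient \<open>\<Psi>(t) / t\<close>, compared at \<open>s\<close> and at \<open>\<Psi>\<^sup>-\<^sup>1(r) \<ge> s\<close>.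
\<close>

lemma inverse_growth_inv_le:
  assumes "growth_function p \<Psi>" "0 < s" "\<Psi> s \<le> r"
  shows "1 / growth_inv \<Psi> r \<le> \<Psi> s / (s * r)"
proof -
  have r: "0 < r" using growth_function_pos[OF assms(1,2)] assms(3) by simp
  define t where "t = growth_inv \<Psi> r"
  have "s \<le> t" using assms r le_growth_inv_iff[OF assms(1), of s r] by (simp add: t_def)
  moreover have "\<Psi> t = r" using growth_function_growth_inv[OF assms(1)] r by (simp add: t_def)
  moreover have "\<Psi> t / t \<le> \<Psi> s / s"
    using assms \<open>s \<le> t\<close> unfolding growth_function_def monotone_on_def by auto
  ultimately have "r / t \<le> \<Psi> s / s" by simp
  then have "r / t / r \<le> \<Psi> s / s / r" using r by (intro divide_right_mono) auto
  then show ?thesis using r by (simp add: t_def)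
qed

text \<open>
  Going down from the largest admissible \<open>n\<close>, lower type makes \<open>\<Phi>(2\<^sup>n)\<close> decay geometrically, so the
  sum is comparable to its largest term. With \<open>\<Phi> = \<Psi>\<close> this sums over the levels of the maximal
  function, with \<open>\<Phi>(t) = t\<^sup>d\<^sup>/\<^sup>2\<close> over the frequency scales.
\<close>

lemma dyadic_sum_le:
  fixes \<Phi> :: "real \<Rightarrow> real"
  assumes "0 < p" and lt: "lower_type p \<Phi>"
    and mono: "mono_on {0..} \<Phi>" and nn: "\<And>t. 0 \<le> t \<Longrightarrow> 0 \<le> \<Phi> t"
  shows "\<exists>C>0. \<forall>w>0. (\<integral>\<^sup>+n. ennreal (\<Phi> (2 powr real_of_int n)) *
            indicator {n. 2 powr real_of_int n \<le> w} n \<partial>count_space UNIV) \<le> ennreal (C * \<Phi> w)"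
proof -
  obtain c where c: "c > 0" "\<And>t s. 0 \<le> t \<Longrightarrow> 0 < s \<Longrightarrow> s < 1 \<Longrightarrow> \<Phi> (s * t) \<le> c * s powr p * \<Phi> t"
    using lt unfolding lower_type_def by auto
  define \<theta> where "\<theta> = 2 powr (- p)"
  have \<theta>: "0 < \<theta>" "\<theta> < 1" using \<open>0 < p\<close> powr_less_mono[of "-p" 0 "2::real"] by (auto simp: \<theta>_def)
  define K where "K = max 1 c"
  have K: "1 \<le> K" "c \<le> K" by (auto simp: K_def)
  show ?thesis
  proof (intro exI[of _ "K / (1 - \<theta>)"] conjI allI impI)
    show "0 < K / (1 - \<theta>)" using \<theta> K by auto
  next
    fix w :: real assume w: "0 < w"
    define m where "m = \<lfloor>log 2 w\<rfloor>"
    have pw: "2 powr real_of_int n \<le> w \<longleftrightarrow> n \<le> m" for n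
      using w by (simp add: m_def le_floor_iff le_log_iff)
    have step: "\<Phi> (2 powr real_of_int (m - int k)) \<le> \<theta> ^ k * (K * \<Phi> w)" for k
    proof -
      have mw: "\<Phi> (2 powr real_of_int m) \<le> \<Phi> w"
        using pw[of m] w mono_onD[OF mono, of "2 powr real_of_int m" w] by auto
      have *: "\<Phi> (2 powr real_of_int (m - int k)) \<le> \<theta> ^ k * K * \<Phi> (2 powr real_of_int m)"
      proof (cases "k = 0")
        case True
        then show ?thesis using K nn[of "2 powr real_of_int m"]
            mult_right_mono[of 1 K "\<Phi> (2 powr real_of_int m)"] by simp
      next
        case False
        have eq: "(2 powr (- real k)) powr p = \<theta> ^ k"
          by (simp add: \<theta>_def powr_powr powr_realpow[symmetric] mult.commute)
        have "2 powr (- real k) < 1" using False powr_less_mono[of "- real k" 0 "2::real"] by auto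
        then have "\<Phi> (2 powr (- real k) * 2 powr real_of_int m)
            \<le> c * \<theta> ^ k * \<Phi> (2 powr real_of_int m)"
          using c(2)[of "2 powr real_of_int m" "2 powr (- real k)"] by (simp add: eq)
        also have "\<dots> \<le> K * \<theta> ^ k * \<Phi> (2 powr real_of_int m)"
          using K \<theta> nn[of "2 powr real_of_int m"] by (intro mult_right_mono) auto
        also have "2 powr (- real k) * 2 powr real_of_int m = 2 powr real_of_int (m - int k)"
          by (simp add: powr_add[symmetric])
        finally show ?thesis by (simp add: mult.commute)
      qed
      also have "\<dots> \<le> \<theta> ^ k * K * \<Phi> w" using mw \<theta> K by (intro mult_left_mono) auto
      finally show ?thesis by (simp add: mult.assoc)
    qed
    \<comment> \<open>The admissible exponents are \<open>m, m - 1, \<dots>\<close>, so the sum is a geometric series in \<open>k\<close>.\<close>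
    have bij: "bij_betw (\<lambda>k. m - int k) UNIV {n. 2 powr real_of_int n \<le> w}"
      by (rule bij_betw_byWitness[where f'="\<lambda>n. nat (m - n)"]) (auto simp: pw)
    have "(\<integral>\<^sup>+n. ennreal (\<Phi> (2 powr real_of_int n)) *
            indicator {n. 2 powr real_of_int n \<le> w} n \<partial>count_space UNIV)
        = (\<integral>\<^sup>+n. ennreal (\<Phi> (2 powr real_of_int n)) \<partial>count_space {n. 2 powr real_of_int n \<le> w})"
      by (simp add: nn_integral_count_space_indicator)
    also have "\<dots> = (\<integral>\<^sup>+k. ennreal (\<Phi> (2 powr real_of_int (m - int k))) \<partial>count_space UNIV)"
      by (rule nn_integral_bij_count_space[OF bij, symmetric])
    also have "\<dots> = (\<Sum>k. ennreal (\<Phi> (2 powr real_of_int (m - int k))))"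
      by (rule nn_integral_count_space_nat)
    also have "\<dots> \<le> (\<Sum>k. ennreal (\<theta> ^ k * (K * \<Phi> w)))"
      using step by (intro suminf_le ennreal_leI) auto
    also have "\<dots> = ennreal (K / (1 - \<theta>) * \<Phi> w)"
    proof (rule suminf_ennreal_eq)
      show "0 \<le> \<theta> ^ k * (K * \<Phi> w)" for k using \<theta> K nn[of w] w by auto
      show "(\<lambda>k. \<theta> ^ k * (K * \<Phi> w)) sums (K / (1 - \<theta>) * \<Phi> w)"
        using sums_mult2[OF geometric_sums, of \<theta> "K * \<Phi> w"] \<theta> by simp
    qed
    finally show "(\<integral>\<^sup>+n. ennreal (\<Phi> (2 powr real_of_int n)) *
            indicator {n. 2 powr real_of_int n \<le> w} n \<partial>count_space UNIV) \<le> ennreal (K / (1 - \<theta>) * \<Phi> w)" .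
  qed
qed

section \<open>Gaussians on Euclidean space\<close>

text \<open>
  Lebesgue measure is the product measure of the coordinates. This reduces the integrals of Gaussians and of
  the weight below to dimension one.
\<close>

lemma
  fixes f :: "'a::euclidean_space \<Rightarrow> real \<Rightarrow> 'b::{real_normed_field,banach,second_countable_topology}"
  assumes f: "\<And>b. b \<in> Basis \<Longrightarrow> integrable lborel (f b)"
  shows integrable_lborel_prod: "integrable lborel (\<lambda>x::'a. \<Prod>b\<in>Basis. f b (x \<bullet> b))"
    and integral_lborel_prod:
      "(LINT x|lborel. (\<Prod>b\<in>Basis. f b ((x::'a) \<bullet> b))) = (\<Prod>b\<in>Basis. LINT x|lborel. f b x)"
proof -
  interpret finite_product_sigma_finite "\<lambda>_. lborel :: real measure" "Basis :: 'a set"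
    by standard simp
  have [measurable]: "f b \<in> borel_measurable borel" if "b \<in> Basis" for b
    using borel_measurable_integrable[OF f[OF that]] by simp
  have [measurable]: "(\<lambda>x::'a. \<Prod>b\<in>Basis. f b (x \<bullet> b)) \<in> borel_measurable borel"
    by measurable
  have [simp]: "(\<Prod>b\<in>Basis. f b ((\<Sum>c\<in>Basis. x c *\<^sub>R c) \<bullet> b)) = (\<Prod>b\<in>Basis. f b (x b))" for x
    by (intro prod.cong) auto
  show "integrable lborel (\<lambda>x::'a. \<Prod>b\<in>Basis. f b (x \<bullet> b))"
    by (subst lborel_eq, subst integrable_distr_eq) (auto intro!: product_integrable_prod f)
  show "(LINT x|lborel. (\<Prod>b\<in>Basis. f b ((x::'a) \<bullet> b))) = (\<Prod>b\<in>Basis. LINT x|lborel. f b x)"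
    by (subst (1) lborel_eq, subst integral_distr) (auto simp: product_integral_prod f)
qed

lemma norm_power2_eq_sum: "(norm (x::'a::euclidean_space))\<^sup>2 = (\<Sum>b\<in>Basis. (x \<bullet> b)\<^sup>2)"
  unfolding power2_norm_eq_inner by (subst euclidean_inner) (simp add: power2_eq_square)

text \<open>
  The product of the one-dimensional functions \<open>1 / (1 + x\<^sub>b\<^sup>2)\<close> is a majorant, because each factor
  \<open>1 + x\<^sub>b\<^sup>2\<close> is at most \<open>(1 + |x|)\<^sup>2\<close>. This weight will dominate every
  rapidly decaying function that has to be integrated.
\<close>

lemma integrable_inverse_power_norm:
  "integrable lborel (\<lambda>x::'a::euclidean_space. 1 / (1 + norm x) ^ (2 * DIM('a)))"
proof (rule Bochner_Integration.integrable_bound)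
  have "integrable lborel (\<lambda>x::real. inverse (1 + x\<^sup>2))"
    using integrable_inverse_1_plus_square by (simp add: set_integrable_def)
  then show "integrable lborel (\<lambda>x::'a. \<Prod>b\<in>Basis. inverse (1 + (x \<bullet> b)\<^sup>2))"
    by (intro integrable_lborel_prod)
  have "1 / (1 + norm x) ^ (2 * DIM('a)) \<le> (\<Prod>b\<in>Basis. inverse (1 + (x \<bullet> b)\<^sup>2))" for x :: 'a
  proof -
    have "(\<Prod>b\<in>(Basis::'a set). inverse ((1 + norm x)\<^sup>2)) \<le> (\<Prod>b\<in>Basis. inverse (1 + (x \<bullet> b)\<^sup>2))"
    proof (intro prod_mono conjI le_imp_inverse_le)
      fix b :: 'a assume b: "b \<in> Basis"
      have "\<bar>x \<bullet> b\<bar>\<^sup>2 \<le> (norm x)\<^sup>2" using Basis_le_norm[OF b, of x] by (intro power_mono) auto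
      then show "1 + (x \<bullet> b)\<^sup>2 \<le> (1 + norm x)\<^sup>2"
        by (simp add: power2_sum add_increasing2)
      show "0 < 1 + (x \<bullet> b)\<^sup>2" by (intro add_pos_nonneg) auto
    qed auto
    then show ?thesis by (simp add: power_mult inverse_eq_divide power_divide)
  qed
  moreover have "0 \<le> (\<Prod>b\<in>Basis. inverse (1 + (x \<bullet> b)\<^sup>2))" for x :: 'a
    by (intro prod_nonneg) auto
  ultimately show "AE x::'a in lborel. norm (1 / (1 + norm x) ^ (2 * DIM('a))) \<le> norm (\<Prod>b\<in>Basis. inverse (1 + (x \<bullet> b)\<^sup>2))"
    by auto
qed measurable

text \<open>
  The parameter is the inverse variance, which the Fourier transform inverts.
\<close>

definition gaussian :: "real \<Rightarrow> 'a::euclidean_space \<Rightarrow> real" where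
  "gaussian s x = exp (- (s * (norm x)\<^sup>2 / 2))"

lemma gaussian_pos [simp]: "0 < gaussian s x"
  and gaussian_nonneg [simp]: "0 \<le> gaussian s x"
  by (auto simp: gaussian_def)

lemma gaussian_le_1 [simp]: "0 \<le> s \<Longrightarrow> gaussian s x \<le> 1"
  by (simp add: gaussian_def)

lemma continuous_on_gaussian [continuous_intros]:
  "continuous_on S f \<Longrightarrow> continuous_on S (\<lambda>x. gaussian s (f x))"
  unfolding gaussian_def by (intro continuous_intros) auto

lemma borel_measurable_gaussian [measurable]: "gaussian s \<in> borel_measurable borel"
  by (intro borel_measurable_continuous_onI continuous_intros)

lemma
  fixes s \<xi> :: real
  assumes s: "0 < s"
  shows integrable_gaussian_real: "integrable lborel (\<lambda>x::real. exp (- (s * x\<^sup>2 / 2)))"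
    and fourier_gaussian_real:
      "(LINT x|lborel. of_real (exp (- (s * x\<^sup>2 / 2))) * exp (- (\<i> * of_real (x * \<xi>))))
        = complex_of_real (sqrt (2 * pi / s) * exp (- (\<xi>\<^sup>2 / s / 2)))"
proof -
  \<comment> \<open>Substituting \<open>r * x\<close> for \<open>x\<close> reduces to the characteristic function of the normal distribution.\<close>
  define r where "r = 1 / sqrt s"
  have r: "r > 0" "s * r\<^sup>2 = 1" using s by (auto simp: r_def power_divide)
  have std: "integrable lborel (\<lambda>x::real. exp (- (x\<^sup>2 / 2)))"
  proof -
    have "integrable lborel (\<lambda>x. sqrt (2 * pi) * std_normal_density x)"
      by (intro integrable_mult_right integrable_normal_density) simp
    then show ?thesis by (simp add: std_normal_density_def)
  qed
  have sc: "s * (0 + r * x)\<^sup>2 / 2 = x\<^sup>2 / 2" for x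
    using r by (simp add: power_mult_distrib mult.assoc[symmetric])
  show "integrable lborel (\<lambda>x::real. exp (- (s * x\<^sup>2 / 2)))"
    using lborel_integrable_real_affine_iff[of r "\<lambda>x::real. exp (- (s * x\<^sup>2 / 2))" 0] r std
    unfolding sc by simp
  have "complex_of_real (exp (- ((- (r * \<xi>))\<^sup>2) / 2)) = char std_normal_distribution (- (r * \<xi>))"
    by (simp add: char_std_normal_distribution)
  also have "\<dots> = (LINT x|lborel. std_normal_density x *\<^sub>R iexp (- (r * \<xi>) * x))"
    unfolding char_def by (subst integral_density) auto
  also have "\<dots> = (LINT x|lborel. of_real (1 / sqrt (2 * pi)) *
      (of_real (exp (- (x\<^sup>2 / 2))) * exp (- (\<i> * of_real (r * x * \<xi>)))))"
    by (intro Bochner_Integration.integral_cong)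
       (auto simp: std_normal_density_def scaleR_conv_of_real algebra_simps)
  also have "\<dots> = of_real (1 / sqrt (2 * pi)) *
      (LINT x|lborel. of_real (exp (- (x\<^sup>2 / 2))) * exp (- (\<i> * of_real (r * x * \<xi>))))"
    by (rule integral_mult_right_zero)
  finally have "(LINT x|lborel. of_real (exp (- (x\<^sup>2 / 2))) * exp (- (\<i> * of_real (r * x * \<xi>))))
      = complex_of_real (sqrt (2 * pi) * exp (- (r\<^sup>2 * \<xi>\<^sup>2 / 2)))"
    by (simp add: field_simps power_mult_distrib)
  moreover have "(LINT x|lborel. of_real (exp (- (s * x\<^sup>2 / 2))) * exp (- (\<i> * of_real (x * \<xi>))))
     = \<bar>r\<bar> *\<^sub>R (LINT x|lborel. of_real (exp (- (x\<^sup>2 / 2))) * exp (- (\<i> * complex_of_real (r * x * \<xi>))))"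
    by (subst lborel_integral_real_affine[where c=r and t=0]) (use r sc in auto)
  ultimately show "(LINT x|lborel. of_real (exp (- (s * x\<^sup>2 / 2))) * exp (- (\<i> * of_real (x * \<xi>))))
        = complex_of_real (sqrt (2 * pi / s) * exp (- (\<xi>\<^sup>2 / s / 2)))"
    using s by (simp add: r_def scaleR_conv_of_real power_divide real_sqrt_divide)
qed

lemma gaussian_eq_prod: "gaussian s x = (\<Prod>b\<in>Basis. exp (- (s * (x \<bullet> b)\<^sup>2 / 2)))"
  by (simp add: gaussian_def norm_power2_eq_sum sum_distrib_left sum_divide_distrib
      flip: exp_sum sum_negf)

lemma integrable_gaussian: "0 < s \<Longrightarrow> integrable lborel (gaussian s :: 'a::euclidean_space \<Rightarrow> real)"
  unfolding gaussian_eq_prod[abs_def] by (intro integrable_lborel_prod integrable_gaussian_real)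

lemma fourier_gaussian:
  fixes \<xi> :: "'a::euclidean_space"
  assumes "0 < s"
  shows "fourier (\<lambda>x. of_real (gaussian s x)) \<xi> = of_real (sqrt (2 * pi / s) ^ DIM('a) * gaussian (1 / s) \<xi>)"
proof -
  have eq: "of_real (gaussian s x) * exp (- (\<i> * of_real (x \<bullet> \<xi>))) =
     (\<Prod>b\<in>Basis. of_real (exp (- (s * (x \<bullet> b)\<^sup>2 / 2))) * exp (- (\<i> * complex_of_real ((x \<bullet> b) * (\<xi> \<bullet> b)))))" for x :: 'a
    by (simp add: gaussian_eq_prod prod.distrib euclidean_inner[of x \<xi>] sum_distrib_left exp_sum
        flip: sum_negf)
  have int: "integrable lborel (\<lambda>x. of_real (exp (- (s * x\<^sup>2 / 2))) * exp (- (\<i> * complex_of_real (x * c))))" for c :: real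
    by (rule Bochner_Integration.integrable_bound[OF integrable_gaussian_real[OF assms]])
       (auto simp: norm_mult)
  have "fourier (\<lambda>x. of_real (gaussian s x)) \<xi> =
    (\<Prod>b\<in>Basis. LINT x|lborel. of_real (exp (- (s * x\<^sup>2 / 2))) * exp (- (\<i> * complex_of_real (x * (\<xi> \<bullet> b)))))"
    unfolding fourier_def eq by (rule integral_lborel_prod[OF int])
  also have "\<dots> = (\<Prod>b\<in>Basis. complex_of_real (sqrt (2 * pi / s) * exp (- ((\<xi> \<bullet> b)\<^sup>2 / s / 2))))"
    by (intro prod.cong refl fourier_gaussian_real assms)
  also have "\<dots> = of_real (sqrt (2 * pi / s) ^ DIM('a) * gaussian (1 / s) \<xi>)"
    by (simp add: gaussian_eq_prod prod.distrib)
  finally show ?thesis .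
qed

lemma lborel_integral_affine:
  fixes f :: "'a::euclidean_space \<Rightarrow> 'b::{banach, second_countable_topology}"
  assumes c: "c \<noteq> 0" and [measurable]: "f \<in> borel_measurable borel"
  shows "(LINT x|lborel. f x) = \<bar>c\<bar> ^ DIM('a) *\<^sub>R (LINT x|lborel. f (t + c *\<^sub>R x))"
proof -
  have "(LINT x|lborel. f x) = (LINT x|distr lborel borel (\<lambda>x. t + c *\<^sub>R x). \<bar>c\<bar> ^ DIM('a) *\<^sub>R f x)"
    by (subst lborel_affine[OF c, of t], subst integral_density) auto
  also have "\<dots> = \<bar>c\<bar> ^ DIM('a) *\<^sub>R (LINT x|lborel. f (t + c *\<^sub>R x))"
    by (subst integral_distr) auto
  finally show ?thesis .
qed

section \<open>Gaussian regularisation of Fourier integrals\<close>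

text \<open>
  Provides the hypothesis of Fubini's theorem for the double integrals below, whose kernels are
  characters.
\<close>

lemma integrable_times_unimodular:
  fixes u :: "'a::euclidean_space \<Rightarrow> complex" and g :: "'b::euclidean_space \<Rightarrow> complex"
  assumes u: "integrable lborel u" and g: "integrable lborel g"
    and k: "continuous_on UNIV (\<lambda>(x, y). k x y)" "\<And>x y. norm (k x y) \<le> 1"
  shows "integrable (lborel \<Otimes>\<^sub>M lborel) (\<lambda>(x, y). u x * g y * k x y)"
proof -
  have [measurable]: "u \<in> borel_measurable borel" "g \<in> borel_measurable borel"
    using u g borel_measurable_integrable by fastforce+
  have [measurable]: "(\<lambda>(x, y). k x y) \<in> borel_measurable (borel \<Otimes>\<^sub>M borel)"
    using borel_measurable_continuous_onI[OF k(1)] by (simp add: borel_prod)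
  have meas: "(\<lambda>(x, y). u x * g y * k x y) \<in> borel_measurable (lborel \<Otimes>\<^sub>M lborel)"
    by measurable
  have "integrable (lborel \<Otimes>\<^sub>M lborel) (\<lambda>(x, y). norm (u x) * norm (g y))"
  proof (rule lborel_pair.Fubini_integrable)
    show "integrable lborel (\<lambda>x. LINT y|lborel. norm (case (x, y) of (x, y) \<Rightarrow> norm (u x) * norm (g y)))"
      using u by (simp add: integrable_norm)
  qed (use g in \<open>auto intro!: integrable_mult_right integrable_norm\<close>)
  then show ?thesis
  proof (rule Bochner_Integration.integrable_bound[OF _ meas])
    show "AE z in lborel \<Otimes>\<^sub>M lborel. norm (case z of (x, y) \<Rightarrow> u x * g y * k x y)
        \<le> norm (case z of (x, y) \<Rightarrow> norm (u x) * norm (g y))"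
    proof (intro always_eventually allI)
      fix z :: "'a \<times> 'b"
      show "norm (case z of (x, y) \<Rightarrow> u x * g y * k x y) \<le> norm (case z of (x, y) \<Rightarrow> norm (u x) * norm (g y))"
        using mult_left_mono[OF k(2), of "norm (u (fst z)) * norm (g (snd z))"]
        by (auto simp: norm_mult split: prod.split)
    qed
  qed
qed

lemma norm_fourier_le: "norm (fourier u \<xi>) \<le> (LINT x|lborel. norm (u x))"
  using integral_norm_bound[of lborel "\<lambda>x. u x * exp (- (\<i> * complex_of_real (x \<bullet> \<xi>)))"]
  by (simp add: fourier_def norm_mult)

lemma continuous_on_fourier:
  assumes u: "integrable lborel u"
  shows "continuous_on UNIV (fourier u)"
proof -
  have "isCont (fourier u) \<xi>" for \<xi>
  proof (rule continuous_at_sequentiallyI)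
    fix X assume X: "X \<longlonglongrightarrow> \<xi>"
    have [measurable]: "u \<in> borel_measurable borel" using borel_measurable_integrable[OF u] by simp
    show "(\<lambda>n. fourier u (X n)) \<longlonglongrightarrow> fourier u \<xi>"
      unfolding fourier_def
    proof (rule integral_dominated_convergence[where w="\<lambda>x. norm (u x)"])
      show "AE x in lborel. (\<lambda>n. u x * exp (- (\<i> * complex_of_real (x \<bullet> X n))))
          \<longlonglongrightarrow> u x * exp (- (\<i> * complex_of_real (x \<bullet> \<xi>)))"
        by (intro always_eventually allI tendsto_intros X)
    qed (use u in \<open>auto simp: norm_mult\<close>)
  qed
  then show ?thesis by (simp add: continuous_on_eq_continuous_at)
qed

lemma borel_measurable_fourier: "integrable lborel u \<Longrightarrow> fourier u \<in> borel_measurable borel"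
  by (intro borel_measurable_continuous_onI continuous_on_fourier)

text \<open>
  After exchanging the integrals, the inner one is the Fourier transform of a Gaussian: damping the
  inversion integral by a Gaussian amounts to averaging \<open>u\<close> against the dual Gaussian.
\<close>

lemma integral_fourier_gaussian:
  fixes u :: "'a::euclidean_space \<Rightarrow> complex"
  assumes u: "integrable lborel u" and s: "0 < s"
  shows "(LINT \<xi>|lborel. fourier u \<xi> * of_real (gaussian s \<xi>) * exp (\<i> * of_real (\<eta> \<bullet> \<xi>)))
    = of_real (sqrt (2 * pi / s) ^ DIM('a)) * (LINT x|lborel. u x * of_real (gaussian (1 / s) (x - \<eta>)))"
proof -
  let ?k = "\<lambda>x \<xi>::'a. exp (- (\<i> * complex_of_real (\<xi> \<bullet> (x - \<eta>))))"
  have k: "?k x \<xi> = exp (- (\<i> * complex_of_real (x \<bullet> \<xi>))) * exp (\<i> * of_real (\<eta> \<bullet> \<xi>))" for x \<xi>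
    by (simp add: inner_diff_right inner_commute algebra_simps flip: exp_add)
  have int: "integrable (lborel \<Otimes>\<^sub>M lborel) (\<lambda>(x, \<xi>). u x * of_real (gaussian s \<xi>) * ?k x \<xi>)"
    by (intro integrable_times_unimodular u integrable_of_real integrable_gaussian s)
       (auto simp: case_prod_unfold intro!: continuous_intros)
  have "(LINT \<xi>|lborel. fourier u \<xi> * of_real (gaussian s \<xi>) * exp (\<i> * of_real (\<eta> \<bullet> \<xi>)))
     = (LINT \<xi>|lborel. LINT x|lborel. u x * of_real (gaussian s \<xi>) * ?k x \<xi>)"
  proof (rule Bochner_Integration.integral_cong[OF refl])
    fix \<xi> :: 'a
    have "(LINT x|lborel. u x * of_real (gaussian s \<xi>) * ?k x \<xi>)
      = (LINT x|lborel. (of_real (gaussian s \<xi>) * exp (\<i> * of_real (\<eta> \<bullet> \<xi>))) * (u x * exp (- (\<i> * complex_of_real (x \<bullet> \<xi>)))))"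
      by (intro Bochner_Integration.integral_cong refl) (simp only: k mult_ac)
    also have "\<dots> = (of_real (gaussian s \<xi>) * exp (\<i> * of_real (\<eta> \<bullet> \<xi>))) * fourier u \<xi>"
      unfolding fourier_def by (rule integral_mult_right_zero)
    finally show "fourier u \<xi> * of_real (gaussian s \<xi>) * exp (\<i> * of_real (\<eta> \<bullet> \<xi>))
      = (LINT x|lborel. u x * of_real (gaussian s \<xi>) * ?k x \<xi>)" by (simp add: mult_ac)
  qed
  also have "\<dots> = (LINT x|lborel. LINT \<xi>|lborel. u x * of_real (gaussian s \<xi>) * ?k x \<xi>)"
    by (rule lborel_pair.Fubini_integral[OF int])
  also have "\<dots> = (LINT x|lborel. of_real (sqrt (2 * pi / s) ^ DIM('a)) * (u x * of_real (gaussian (1 / s) (x - \<eta>))))"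
  proof (rule Bochner_Integration.integral_cong[OF refl])
    fix x :: 'a
    have "(LINT \<xi>|lborel. u x * of_real (gaussian s \<xi>) * ?k x \<xi>) = u x * fourier (\<lambda>x. of_real (gaussian s x)) (x - \<eta>)"
      unfolding fourier_def mult.assoc by (rule integral_mult_right_zero)
    then show "(LINT \<xi>|lborel. u x * of_real (gaussian s \<xi>) * ?k x \<xi>)
       = of_real (sqrt (2 * pi / s) ^ DIM('a)) * (u x * of_real (gaussian (1 / s) (x - \<eta>)))"
      by (simp add: fourier_gaussian[OF s])
  qed
  also have "\<dots> = of_real (sqrt (2 * pi / s) ^ DIM('a)) * (LINT x|lborel. u x * of_real (gaussian (1 / s) (x - \<eta>)))"
    by (rule integral_mult_right_zero)
  finally show ?thesis .
qed

lemma integral_gaussian_1: "(LINT x::'a::euclidean_space|lborel. gaussian 1 x) = sqrt (2 * pi) ^ DIM('a)"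
proof -
  have "complex_of_real (LINT x::'a|lborel. gaussian 1 x) = of_real (sqrt (2 * pi) ^ DIM('a))"
    using fourier_gaussian[of 1 "0::'a"] by (simp add: fourier_def gaussian_def)
  then show ?thesis using of_real_eq_iff by blast
qed

text \<open>
  The substitution \<open>x = \<eta> + r z\<close> moves the parameter from the kernel into \<open>u\<close>, where its limit can be
  taken by dominated convergence.
\<close>

lemma integral_fourier_gaussian_rescaled:
  fixes u :: "'a::euclidean_space \<Rightarrow> complex"
  assumes u: "integrable lborel u" and r: "0 < r"
  shows "(LINT \<xi>|lborel. fourier u \<xi> * of_real (gaussian (r\<^sup>2) \<xi>) * exp (\<i> * of_real (\<eta> \<bullet> \<xi>)))
    = of_real (sqrt (2 * pi) ^ DIM('a)) * (LINT z|lborel. u (\<eta> + r *\<^sub>R z) * of_real (gaussian 1 z))"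
proof -
  have [measurable]: "u \<in> borel_measurable borel" using borel_measurable_integrable[OF u] by simp
  have "(LINT x|lborel. u x * of_real (gaussian (1 / r\<^sup>2) (x - \<eta>)))
      = r ^ DIM('a) *\<^sub>R (LINT z|lborel. u (\<eta> + r *\<^sub>R z) * of_real (gaussian (1 / r\<^sup>2) (\<eta> + r *\<^sub>R z - \<eta>)))"
    by (subst lborel_integral_affine[where c=r and t=\<eta>]) (use r in auto)
  also have "(\<lambda>z. gaussian (1 / r\<^sup>2) (\<eta> + r *\<^sub>R z - \<eta>)) = gaussian 1"
    using r by (auto simp: gaussian_def power_mult_distrib fun_eq_iff)
  then have "(LINT z|lborel. u (\<eta> + r *\<^sub>R z) * of_real (gaussian (1 / r\<^sup>2) (\<eta> + r *\<^sub>R z - \<eta>)))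
     = (LINT z|lborel. u (\<eta> + r *\<^sub>R z) * of_real (gaussian 1 z))" by metis
  finally have *: "(LINT x|lborel. u x * of_real (gaussian (1 / r\<^sup>2) (x - \<eta>)))
     = of_real (r ^ DIM('a)) * (LINT z|lborel. u (\<eta> + r *\<^sub>R z) * of_real (gaussian 1 z))"
    by (simp add: scaleR_conv_of_real)
  have "sqrt (2 * pi / r\<^sup>2) ^ DIM('a) * r ^ DIM('a) = sqrt (2 * pi) ^ DIM('a)"
    using r by (simp add: real_sqrt_divide flip: power_mult_distrib)
  then have "complex_of_real (sqrt (2 * pi / r\<^sup>2) ^ DIM('a)) * of_real (r ^ DIM('a)) = of_real (sqrt (2 * pi) ^ DIM('a))"
    by (metis of_real_mult)
  then show ?thesis
    using integral_fourier_gaussian[OF u, of "r\<^sup>2" \<eta>] r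
    by (simp only: * zero_less_power mult.assoc[symmetric])
qed

text \<open>
  Inversion for a regularised integral. The bound is uniform in the parameter; it dominates
  the limit when the formula is integrated once more.
\<close>

lemma
  fixes u :: "'a::euclidean_space \<Rightarrow> complex"
  assumes u: "integrable lborel u" and cont: "continuous_on UNIV u" and bd: "\<And>x. norm (u x) \<le> K"
  shows norm_gaussian_inversion_le: "0 < r \<Longrightarrow>
      norm (LINT \<xi>|lborel. fourier u \<xi> * of_real (gaussian (r\<^sup>2) \<xi>) * exp (\<i> * of_real (\<eta> \<bullet> \<xi>))) \<le> (2 * pi) ^ DIM('a) * K"
    and tendsto_gaussian_inversion:
      "(\<lambda>n. LINT \<xi>|lborel. fourier u \<xi> * of_real (gaussian ((inverse (real (Suc n)))\<^sup>2) \<xi>) * exp (\<i> * of_real (\<eta> \<bullet> \<xi>)))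
        \<longlonglongrightarrow> of_real ((2 * pi) ^ DIM('a)) * u \<eta>"
proof -
  have [measurable]: "u \<in> borel_measurable borel" using borel_measurable_integrable[OF u] by simp
  have K: "0 \<le> K" using bd[of 0] norm_ge_zero[of "u 0"] by linarith
  have sq: "sqrt (2 * pi) ^ DIM('a) * sqrt (2 * pi) ^ DIM('a) = (2 * pi) ^ DIM('a)"
    unfolding power_mult_distrib[of "sqrt (2 * pi)", symmetric] by simp
  have dom: "integrable lborel (\<lambda>z::'a. K * gaussian 1 z)"
    by (intro integrable_mult_right integrable_gaussian) simp
  show "norm (LINT \<xi>|lborel. fourier u \<xi> * of_real (gaussian (r\<^sup>2) \<xi>) * exp (\<i> * of_real (\<eta> \<bullet> \<xi>))) \<le> (2 * pi) ^ DIM('a) * K"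
    if r: "0 < r"
  proof -
    have "norm (LINT z|lborel. u (\<eta> + r *\<^sub>R z) * of_real (gaussian 1 z)) \<le> (LINT z::'a|lborel. K * gaussian 1 z)"
    proof (rule Bochner_Integration.integral_norm_bound_integral[OF _ dom])
      show "integrable lborel (\<lambda>z. u (\<eta> + r *\<^sub>R z) * of_real (gaussian 1 z))"
        by (rule Bochner_Integration.integrable_bound[OF dom])
           (use bd K in \<open>auto simp: norm_mult mult_right_mono\<close>)
    qed (use bd in \<open>auto simp: norm_mult mult_right_mono\<close>)
    also have "\<dots> = K * sqrt (2 * pi) ^ DIM('a)" by (simp add: integral_gaussian_1)
    finally show ?thesis
      unfolding integral_fourier_gaussian_rescaled[OF u r] norm_mult sq[symmetric]
      by (simp add: norm_power mult.assoc mult_left_mono mult.commute)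
  qed
  have "(\<lambda>n. LINT z|lborel. u (\<eta> + inverse (real (Suc n)) *\<^sub>R z) * of_real (gaussian 1 z))
     \<longlonglongrightarrow> (LINT z|lborel. u \<eta> * of_real (gaussian 1 (z::'a)))"
  proof (rule integral_dominated_convergence[OF _ _ dom])
    show "AE z::'a in lborel. (\<lambda>n. u (\<eta> + inverse (real (Suc n)) *\<^sub>R z) * of_real (gaussian 1 z)) \<longlonglongrightarrow> u \<eta> * of_real (gaussian 1 z)"
    proof (intro always_eventually allI tendsto_mult tendsto_const)
      fix z :: 'a
      have "(\<lambda>n. \<eta> + inverse (real (Suc n)) *\<^sub>R z) \<longlonglongrightarrow> \<eta> + 0 *\<^sub>R z"
        by (intro tendsto_intros LIMSEQ_inverse_real_of_nat)
      then show "(\<lambda>n. u (\<eta> + inverse (real (Suc n)) *\<^sub>R z)) \<longlonglongrightarrow> u \<eta>"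
        using cont isCont_tendsto_compose[of \<eta> u] by (auto simp: continuous_on_eq_continuous_at)
    qed
  qed (use bd in \<open>auto simp: norm_mult mult_right_mono\<close>)
  then have "(\<lambda>n. of_real (sqrt (2 * pi) ^ DIM('a)) * (LINT z|lborel. u (\<eta> + inverse (real (Suc n)) *\<^sub>R z) * of_real (gaussian 1 z)))
     \<longlonglongrightarrow> of_real (sqrt (2 * pi) ^ DIM('a)) * (u \<eta> * of_real (sqrt (2 * pi) ^ DIM('a)))"
    by (intro tendsto_mult tendsto_const) (simp add: integral_gaussian_1)
  moreover have pos: "0 < inverse (real (Suc n))" for n by simp
  moreover have "complex_of_real (sqrt (2 * pi) ^ DIM('a)) * (u \<eta> * of_real (sqrt (2 * pi) ^ DIM('a))) = of_real ((2 * pi) ^ DIM('a)) * u \<eta>"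
    unfolding sq[symmetric] by simp
  ultimately show "(\<lambda>n. LINT \<xi>|lborel. fourier u \<xi> * of_real (gaussian ((inverse (real (Suc n)))\<^sup>2) \<xi>) * exp (\<i> * of_real (\<eta> \<bullet> \<xi>)))
        \<longlonglongrightarrow> of_real ((2 * pi) ^ DIM('a)) * u \<eta>"
    by (simp only: integral_fourier_gaussian_rescaled[OF u] pos)
qed

lemma ennreal_norm_integral_le:
  fixes f :: "'a \<Rightarrow> 'b::{banach, second_countable_topology}"
  shows "ennreal (norm (integral\<^sup>L M f)) \<le> (\<integral>\<^sup>+x. ennreal (norm (f x)) \<partial>M)"
  by (cases "integrable M f") (auto simp: integral_norm_bound_ennreal not_integrable_integral_eq)

text \<open>
  Regularised inversion, with the Gaussian factor estimated by \<open>1\<close> before the limit is taken.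
\<close>

lemma norm_le_nn_integral_fourier:
  fixes u :: "'a::euclidean_space \<Rightarrow> complex"
  assumes u: "integrable lborel u" and cont: "continuous_on UNIV u" and bd: "\<And>x. norm (u x) \<le> K"
  shows "ennreal ((2 * pi) ^ DIM('a) * norm (u \<eta>)) \<le> (\<integral>\<^sup>+\<xi>. ennreal (norm (fourier u \<xi>)) \<partial>lborel)"
proof (rule LIMSEQ_le_const2)
  let ?J = "\<lambda>n. LINT \<xi>|lborel. fourier u \<xi> * of_real (gaussian ((inverse (real (Suc n)))\<^sup>2) \<xi>) * exp (\<i> * of_real (\<eta> \<bullet> \<xi>))"
  have "(\<lambda>n. norm (?J n)) \<longlonglongrightarrow> norm (of_real ((2 * pi) ^ DIM('a)) * u \<eta>)"
    by (intro tendsto_norm tendsto_gaussian_inversion[OF u cont bd])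
  then show "(\<lambda>n. ennreal (norm (?J n))) \<longlonglongrightarrow> ennreal ((2 * pi) ^ DIM('a) * norm (u \<eta>))"
    by (intro tendsto_ennrealI) (simp add: norm_mult norm_power)
  have "ennreal (norm (?J n)) \<le> (\<integral>\<^sup>+\<xi>. ennreal (norm (fourier u \<xi>)) \<partial>lborel)" for n
    by (rule order_trans[OF ennreal_norm_integral_le nn_integral_mono])
       (auto simp: norm_mult intro!: ennreal_leI mult_left_le)
  then show "\<exists>N. \<forall>n\<ge>N. ennreal (norm (?J n)) \<le> (\<integral>\<^sup>+\<xi>. ennreal (norm (fourier u \<xi>)) \<partial>lborel)" by blast
qed

text \<open>
  One half of Plancherel's theorem. Multiplying the regularised inversion formula by the conjugate of
  \<open>u\<close> and integrating expresses \<open>\<integral> |u^|\<^sup>2 gaussian\<close> through quantities that converge to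
  \<open>(2\<pi>)\<^sup>d \<integral> |u|\<^sup>2\<close>, while the Gaussian is at most \<open>1\<close>.
\<close>

lemma nn_integral_power2_le_fourier:
  fixes u :: "'a::euclidean_space \<Rightarrow> complex"
  assumes u: "integrable lborel u" and cont: "continuous_on UNIV u" and bd: "\<And>x. norm (u x) \<le> K"
  shows "ennreal ((2 * pi) ^ DIM('a)) * (\<integral>\<^sup>+x. ennreal ((norm (u x))\<^sup>2) \<partial>lborel)
    \<le> (\<integral>\<^sup>+\<xi>. ennreal ((norm (fourier u \<xi>))\<^sup>2) \<partial>lborel)"
proof (rule LIMSEQ_le_const2)
  let ?r = "\<lambda>n. (inverse (real (Suc n)))\<^sup>2"
  let ?J = "\<lambda>n \<eta>. LINT \<xi>|lborel. fourier u \<xi> * of_real (gaussian (?r n) \<xi>) * exp (\<i> * of_real (\<eta> \<bullet> \<xi>))"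
  let ?A = "\<lambda>n. LINT \<xi>|lborel. fourier u \<xi> * of_real (gaussian (?r n) \<xi>) * cnj (fourier u \<xi>)"
  have [measurable]: "u \<in> borel_measurable borel" using borel_measurable_integrable[OF u] by simp
  have [measurable]: "fourier u \<in> borel_measurable borel" by (rule borel_measurable_fourier[OF u])
  have [measurable]: "(\<lambda>x. cnj (u x)) \<in> borel_measurable borel"
    by (intro borel_measurable_continuous_onI continuous_intros cont)
  have K: "0 \<le> K" using bd[of 0] norm_ge_zero[of "u 0"] by linarith
  have F: "integrable lborel (\<lambda>\<xi>. fourier u \<xi> * of_real (gaussian (?r n) \<xi>))" for n
    by (rule Bochner_Integration.integrable_bound[where f="\<lambda>\<xi>. (LINT x|lborel. norm (u x)) * gaussian (?r n) \<xi>"])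
       (auto simp: norm_mult intro!: integrable_mult_right integrable_gaussian mult_right_mono
         order_trans[OF norm_fourier_le])
  have [measurable]: "?J n \<in> borel_measurable borel" for n
  proof -
    \<comment> \<open>As a Fourier transform of an integrable function, \<open>?J n\<close> is continuous, hence measurable.\<close>
    have J: "?J n = (\<lambda>\<eta>. fourier (\<lambda>\<xi>. fourier u \<xi> * of_real (gaussian (?r n) \<xi>)) (- \<eta>))"
      by (simp add: fourier_def inner_commute fun_eq_iff)
    show ?thesis unfolding J by (rule measurable_compose[OF _ borel_measurable_fourier[OF F]]) simp
  qed
  have A: "?A n = (LINT \<eta>|lborel. cnj (u \<eta>) * ?J n \<eta>)" for n
  proof -
    have int: "integrable (lborel \<Otimes>\<^sub>M lborel) (\<lambda>(\<eta>, \<xi>). cnj (u \<eta>) *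
        (fourier u \<xi> * of_real (gaussian (?r n) \<xi>)) * exp (\<i> * of_real (\<eta> \<bullet> \<xi>)))"
      by (intro integrable_times_unimodular F) (auto simp: u case_prod_unfold intro!: continuous_intros)
    have "cnj (fourier u \<xi>) = (LINT \<eta>|lborel. cnj (u \<eta>) * exp (\<i> * of_real (\<eta> \<bullet> \<xi>)))" for \<xi>
      unfolding fourier_def by (subst Bochner_Integration.integral_cnj[symmetric]) (simp add: exp_cnj)
    then have "?A n = (LINT \<xi>|lborel. LINT \<eta>|lborel. cnj (u \<eta>) *
        (fourier u \<xi> * of_real (gaussian (?r n) \<xi>)) * exp (\<i> * of_real (\<eta> \<bullet> \<xi>)))"
      by (simp add: mult_ac flip: integral_mult_right_zero)
    also have "\<dots> = (LINT \<eta>|lborel. LINT \<xi>|lborel. cnj (u \<eta>) *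
        (fourier u \<xi> * of_real (gaussian (?r n) \<xi>)) * exp (\<i> * of_real (\<eta> \<bullet> \<xi>)))"
      by (rule lborel_pair.Fubini_integral[OF int])
    also have "\<dots> = (LINT \<eta>|lborel. cnj (u \<eta>) * ?J n \<eta>)"
      by (simp add: mult.assoc flip: integral_mult_right_zero)
    finally show ?thesis .
  qed
  have dom: "integrable lborel (\<lambda>\<eta>. norm (u \<eta>) * ((2 * pi) ^ DIM('a) * K))"
    using u by (intro integrable_mult_left integrable_norm)
  have lim: "(\<lambda>n. ?A n) \<longlonglongrightarrow> (LINT \<eta>|lborel. cnj (u \<eta>) * (of_real ((2 * pi) ^ DIM('a)) * u \<eta>))"
    unfolding A
  proof (rule integral_dominated_convergence[OF _ _ dom])
    show "AE \<eta> in lborel. (\<lambda>n. cnj (u \<eta>) * ?J n \<eta>) \<longlonglongrightarrow> cnj (u \<eta>) * (of_real ((2 * pi) ^ DIM('a)) * u \<eta>)"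
      by (intro always_eventually allI tendsto_mult tendsto_const tendsto_gaussian_inversion[OF u cont bd])
    show "AE \<eta> in lborel. norm (cnj (u \<eta>) * ?J n \<eta>) \<le> norm (u \<eta>) * ((2 * pi) ^ DIM('a) * K)" for n
      unfolding norm_mult complex_mod_cnj
      by (intro always_eventually allI mult_left_mono norm_gaussian_inversion_le[OF u cont bd]) simp_all
  qed (measurable)
  have val: "(LINT \<eta>|lborel. cnj (u \<eta>) * (of_real ((2 * pi) ^ DIM('a)) * u \<eta>))
     = of_real ((2 * pi) ^ DIM('a) * (LINT x|lborel. (norm (u x))\<^sup>2))"
  proof -
    have "cnj (u \<eta>) * (of_real ((2 * pi) ^ DIM('a)) * u \<eta>) = of_real ((2 * pi) ^ DIM('a) * (norm (u \<eta>))\<^sup>2)" for \<eta>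
      by (simp add: complex_norm_square mult_ac del: of_real_power)
    then show ?thesis by (simp only: integral_complex_of_real integral_mult_right_zero)
  qed
  have "(\<lambda>n. norm (?A n)) \<longlonglongrightarrow> norm (complex_of_real ((2 * pi) ^ DIM('a) * (LINT x|lborel. (norm (u x))\<^sup>2)))"
    using tendsto_norm[OF lim] unfolding val .
  moreover have "norm (complex_of_real ((2 * pi) ^ DIM('a) * (LINT x|lborel. (norm (u x))\<^sup>2))) =
      (2 * pi) ^ DIM('a) * (LINT x|lborel. (norm (u x))\<^sup>2)"
    unfolding norm_of_real by (intro abs_of_nonneg mult_nonneg_nonneg Bochner_Integration.integral_nonneg) auto
  ultimately have "(\<lambda>n. ennreal (norm (?A n))) \<longlonglongrightarrow> ennreal ((2 * pi) ^ DIM('a) * (LINT x|lborel. (norm (u x))\<^sup>2))"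
    by (intro tendsto_ennrealI) simp
  moreover have "integrable lborel (\<lambda>x. (norm (u x))\<^sup>2)"
    by (rule Bochner_Integration.integrable_bound[where f="\<lambda>x. K * norm (u x)"])
       (use u bd K in \<open>auto simp: power2_eq_square mult_right_mono\<close>)
  ultimately show "(\<lambda>n. ennreal (norm (?A n))) \<longlonglongrightarrow> ennreal ((2 * pi) ^ DIM('a)) * (\<integral>\<^sup>+x. ennreal ((norm (u x))\<^sup>2) \<partial>lborel)"
    by (simp add: nn_integral_eq_integral ennreal_mult)
  have "ennreal (norm (?A n)) \<le> (\<integral>\<^sup>+\<xi>. ennreal ((norm (fourier u \<xi>))\<^sup>2) \<partial>lborel)" for n
    by (rule order_trans[OF ennreal_norm_integral_le nn_integral_mono])
       (auto simp: norm_mult power2_eq_square mult_left_le intro!: ennreal_leI mult_right_mono)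
  then show "\<exists>N. \<forall>n\<ge>N. ennreal (norm (?A n)) \<le> (\<integral>\<^sup>+\<xi>. ennreal ((norm (fourier u \<xi>))\<^sup>2) \<partial>lborel)" by blast
qed

section \<open>Fourier transforms of Schwartz functions\<close>

lemma partial_deriv_append: "partial_deriv (as @ bs) f = partial_deriv as (partial_deriv bs f)"
  by (induction as) auto

lemma schwartz_partial_deriv:
  assumes "f \<in> schwartz" "b \<in> Basis"
  shows "partial_deriv [b] f \<in> schwartz"
proof -
  have eq: "partial_deriv bs (partial_deriv [b] f) = partial_deriv (bs @ [b]) f" for bs
    by (simp only: partial_deriv_append)
  show ?thesis
    using assms unfolding schwartz_def smooth_def mem_Collect_eq eq by simp
qed

lemma schwartz_has_derivative:
  assumes "f \<in> schwartz"
  shows "(f has_derivative frechet_derivative f (at x)) (at x)"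
proof -
  have "partial_deriv [] f differentiable_on UNIV"
    using assms unfolding schwartz_def smooth_def by (metis (mono_tags, lifting) empty_subsetI list.set(1) mem_Collect_eq)
  then show ?thesis by (simp add: differentiable_on_def frechet_derivative_works)
qed

lemma continuous_on_schwartz: "f \<in> schwartz \<Longrightarrow> continuous_on UNIV f"
  by (intro continuous_at_imp_continuous_on ballI has_derivative_continuous[OF schwartz_has_derivative])

lemma schwartz_bound:
  fixes f :: "'a::euclidean_space \<Rightarrow> complex"
  assumes "f \<in> schwartz"
  shows "\<exists>C\<ge>0. \<forall>x. norm (f x) \<le> C / (1 + norm x) ^ N"
proof -
  have "set [] \<subseteq> (Basis :: 'a set)" by simp
  then have "\<exists>C. \<forall>x. (1 + norm x) ^ N * norm (partial_deriv [] f x) \<le> C"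
    using assms unfolding schwartz_def mem_Collect_eq by blast
  then obtain C where C: "\<And>x. (1 + norm x) ^ N * norm (f x) \<le> C" by auto
  have "norm (f x) \<le> C / (1 + norm x) ^ N" for x
  proof -
    have "0 < (1 + norm x) ^ N" by (intro zero_less_power add_pos_nonneg) auto
    then show ?thesis using C[of x] by (simp add: field_simps)
  qed
  moreover have "0 \<le> C" using C[of 0] order_trans[OF norm_ge_zero[of "f 0"]] by simp
  ultimately show ?thesis by blast
qed

lemma integrable_rapid_decay:
  fixes f :: "'a::euclidean_space \<Rightarrow> complex"
  assumes "continuous_on UNIV f" and bd: "\<And>x. norm (f x) \<le> C / (1 + norm x) ^ (2 * DIM('a))"
  shows "integrable lborel f"
proof (rule Bochner_Integration.integrable_bound)
  show "integrable lborel (\<lambda>x::'a. C * (1 / (1 + norm x) ^ (2 * DIM('a))))"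
    by (intro integrable_mult_right integrable_inverse_power_norm)
  show "AE x in lborel. norm (f x) \<le> norm (C * (1 / (1 + norm x) ^ (2 * DIM('a))))"
    using bd by (intro always_eventually allI) (metis abs_ge_self mult.right_neutral order_trans real_norm_def times_divide_eq_right)
qed (use assms(1) borel_measurable_continuous_onI in auto)

lemma integrable_schwartz:
  assumes "f \<in> schwartz" shows "integrable lborel f"
proof -
  obtain C where "\<And>x::'a. norm (f x) \<le> C / (1 + norm x) ^ (2 * DIM('a))"
    using schwartz_bound[OF assms] by blast
  then show ?thesis by (intro integrable_rapid_decay continuous_on_schwartz assms)
qed

text \<open>
  By translation invariance every difference quotient of \<open>F\<close> has integral \<open>0\<close>; the decay of the
  derivative allows the limit under the integral.
\<close>

lemma integral_directional_derivative_eq_0: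
  fixes F :: "'a::euclidean_space \<Rightarrow> complex"
  assumes F: "integrable lborel F" and der: "\<And>x. (F has_derivative D x) (at x)"
    and b: "norm b \<le> 1" and D: "continuous_on UNIV (\<lambda>x. D x b)"
    and bd: "\<And>x. norm (D x b) \<le> C / (1 + norm x) ^ (2 * DIM('a))" and C: "0 \<le> C"
  shows "(LINT x|lborel. D x b) = 0"
proof -
  have [measurable]: "F \<in> borel_measurable borel" using borel_measurable_integrable[OF F] by simp
  have [measurable]: "(\<lambda>x. D x b) \<in> borel_measurable borel" using D by (rule borel_measurable_continuous_onI)
  let ?Q = "\<lambda>n x. real (Suc n) *\<^sub>R (F (x + (1 / real (Suc n)) *\<^sub>R b) - F x)"
  have D_scale: "D x (c *\<^sub>R b) = c *\<^sub>R D x b" for x c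
    using linear_scale[OF has_derivative_linear[OF der]] .
  have "(\<lambda>n. LINT x|lborel. ?Q n x) \<longlonglongrightarrow> (LINT x|lborel. D x b)"
  proof (rule integral_dominated_convergence)
    show "integrable lborel (\<lambda>x::'a. C * 2 ^ (2 * DIM('a)) * (1 / (1 + norm x) ^ (2 * DIM('a))))"
      by (intro integrable_mult_right integrable_inverse_power_norm)
    show "AE x in lborel. (\<lambda>n. ?Q n x) \<longlonglongrightarrow> D x b"
    proof (intro always_eventually allI)
      fix x
      have "((\<lambda>t. F (x + t *\<^sub>R b)) has_derivative (\<lambda>t. D (x + 0 *\<^sub>R b) (0 + t *\<^sub>R b))) (at 0)"
        by (rule has_derivative_compose[where f="\<lambda>t. x + t *\<^sub>R b" and g=F])
           (auto intro!: derivative_eq_intros der)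
      then have lim: "((\<lambda>t. norm (F (x + t *\<^sub>R b) - F x - t *\<^sub>R D x b) / \<bar>t\<bar>) \<longlongrightarrow> 0) (at 0)"
        by (simp add: has_derivative_iff_norm D_scale)
      have eq: "norm (F (x + t *\<^sub>R b) - F x - t *\<^sub>R D x b) / \<bar>t\<bar>
          = norm ((F (x + t *\<^sub>R b) - F x) /\<^sub>R t - D x b)" if "t \<noteq> 0" for t
      proof -
        have "(F (x + t *\<^sub>R b) - F x) /\<^sub>R t - D x b = (F (x + t *\<^sub>R b) - F x - t *\<^sub>R D x b) /\<^sub>R t"
          using that by (simp add: scaleR_diff_right)
        then show ?thesis by (simp add: divide_inverse mult.commute)
      qed
      have "((\<lambda>t. norm ((F (x + t *\<^sub>R b) - F x) /\<^sub>R t - D x b)) \<longlongrightarrow> 0) (at 0)"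
        by (rule Lim_transform_eventually[OF lim]) (simp add: eventually_at_filter eq)
      then have "((\<lambda>t. (F (x + t *\<^sub>R b) - F x) /\<^sub>R t) \<longlongrightarrow> D x b) (at 0)"
        by (simp add: tendsto_norm_zero_iff LIM_zero_iff)
      moreover have "filterlim (\<lambda>n. 1 / real (Suc n)) (at 0) sequentially"
        using LIMSEQ_Suc[OF lim_1_over_n[where 'a=real]] by (simp add: filterlim_at)
      ultimately have "(\<lambda>n. (F (x + (1 / real (Suc n)) *\<^sub>R b) - F x) /\<^sub>R (1 / real (Suc n))) \<longlonglongrightarrow> D x b"
        by (rule filterlim_compose)
      then show "(\<lambda>n. ?Q n x) \<longlonglongrightarrow> D x b" by (simp only: inverse_divide div_by_1)
    qed
    show "AE x in lborel. norm (?Q n x) \<le> C * 2 ^ (2 * DIM('a)) * (1 / (1 + norm x) ^ (2 * DIM('a)))" for n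
    proof (intro always_eventually allI)
      fix x
      define h where "h = 1 / real (Suc n)"
      have h: "0 < h" "h \<le> 1" by (auto simp: h_def)
      have d: "((\<lambda>t. F (x + t *\<^sub>R b)) has_derivative (\<lambda>s. D (x + t *\<^sub>R b) (0 + s *\<^sub>R b))) (at t)" for t
        by (rule has_derivative_compose[where f="\<lambda>t. x + t *\<^sub>R b" and g=F])
           (auto intro!: derivative_eq_intros der)
      obtain t where t: "0 < t" "t < h" and
        le: "norm (F (x + h *\<^sub>R b) - F (x + 0 *\<^sub>R b)) \<le> norm (D (x + t *\<^sub>R b) (0 + (h - 0) *\<^sub>R b))"
      proof -
        have "continuous_on {0..h} (\<lambda>t. F (x + t *\<^sub>R b))"
          by (intro continuous_at_imp_continuous_on ballI has_derivative_continuous[OF d])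
        from mvt_general[OF h(1) this d] that show ?thesis by auto
      qed
      have "norm (t *\<^sub>R b) \<le> 1" using t h b mult_mono[of t 1 "norm b" 1] by auto
      moreover have "norm x \<le> norm (x + t *\<^sub>R b) + norm (t *\<^sub>R b)"
        using norm_triangle_ineq4[of "x + t *\<^sub>R b" "t *\<^sub>R b"] by simp
      moreover have "1 + n \<le> 2 * (1 + m)" if "q \<le> 1" "n \<le> m + q" "0 \<le> m" for n m q :: real
        using that by (simp add: algebra_simps)
      ultimately have "1 + norm x \<le> 2 * (1 + norm (x + t *\<^sub>R b))"
        using norm_ge_zero by blast
      \<comment> \<open>The weights at two points of distance at most \<open>1\<close> are comparable.\<close>
      then have a: "(1 + norm x) ^ (2 * DIM('a)) \<le> 2 ^ (2 * DIM('a)) * (1 + norm (x + t *\<^sub>R b)) ^ (2 * DIM('a))"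
        by (metis add_nonneg_nonneg norm_ge_zero power_mono power_mult_distrib zero_le_one)
      have pos: "0 < (1 + norm y) ^ (2 * DIM('a))" for y :: 'a
        by (intro zero_less_power add_pos_nonneg) auto
      have "C / (1 + norm (x + t *\<^sub>R b)) ^ (2 * DIM('a)) \<le> C * 2 ^ (2 * DIM('a)) * (1 / (1 + norm x) ^ (2 * DIM('a)))"
        using mult_left_mono[OF a C] pos[of x] pos[of "x + t *\<^sub>R b"]
        by (simp add: divide_simps mult.assoc del: zero_less_power_eq)
      then have "norm (D (x + t *\<^sub>R b) b) \<le> C * 2 ^ (2 * DIM('a)) * (1 / (1 + norm x) ^ (2 * DIM('a)))"
        using bd order_trans by blast
      moreover have "norm (?Q n x) \<le> norm (D (x + t *\<^sub>R b) b)"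
      proof -
        have "norm (?Q n x) = (1 / h) * norm (F (x + h *\<^sub>R b) - F x)" by (simp add: h_def)
        also have "\<dots> \<le> (1 / h) * (h * norm (D (x + t *\<^sub>R b) b))"
          using le h by (intro mult_left_mono) (auto simp: D_scale)
        finally show ?thesis using h by simp
      qed
      ultimately show "norm (?Q n x) \<le> C * 2 ^ (2 * DIM('a)) * (1 / (1 + norm x) ^ (2 * DIM('a)))" by linarith
    qed
  qed measurable
  moreover have "(LINT x|lborel. ?Q n x) = 0" for n
  proof -
    let ?v = "(1 / real (Suc n)) *\<^sub>R b"
    have eq: "(LINT x|lborel. F (x + ?v)) = (LINT x|lborel. F x)"
      using lborel_integral_affine[of 1 F ?v] by (simp add: add.commute)
    have "integrable (distr lborel borel ((+) ?v)) F" by (subst lborel_distr_plus) (rule F)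
    then have "integrable lborel (\<lambda>x. F (?v + x))" by (subst (asm) integrable_distr_eq) auto
    then have "integrable lborel (\<lambda>x. F (x + ?v))" by (simp only: add.commute)
    then show ?thesis using F eq by (simp del: of_nat_Suc)
  qed
  ultimately show ?thesis using LIMSEQ_unique[OF _ tendsto_const[of 0]] by simp
qed

text \<open>
  The previous lemma for the product of \<open>f\<close> with a character.
\<close>

lemma fourier_partial_deriv:
  fixes f :: "'a::euclidean_space \<Rightarrow> complex"
  assumes f: "f \<in> schwartz" and b: "b \<in> Basis"
  shows "fourier (partial_deriv [b] f) \<xi> = \<i> * of_real (\<xi> \<bullet> b) * fourier f \<xi>"
proof -
  let ?e = "\<lambda>x. exp (- (\<i> * complex_of_real (x \<bullet> \<xi>)))"
  let ?D = "\<lambda>x v. f x * (- (\<i> * of_real (v \<bullet> \<xi>)) * ?e x) + frechet_derivative f (at x) v * ?e x"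
  have f': "partial_deriv [b] f \<in> schwartz" by (rule schwartz_partial_deriv[OF f b])
  obtain C where C: "C \<ge> 0" "\<And>x. norm (f x) \<le> C / (1 + norm x) ^ (2 * DIM('a))"
    using schwartz_bound[OF f] by blast
  obtain C' where C': "C' \<ge> 0" "\<And>x. norm (partial_deriv [b] f x) \<le> C' / (1 + norm x) ^ (2 * DIM('a))"
    using schwartz_bound[OF f'] by blast
  have e: "(?e has_derivative (\<lambda>v. - (\<i> * of_real (v \<bullet> \<xi>)) * ?e x)) (at x)" for x
  proof -
    have "((\<lambda>x. - (\<i> * complex_of_real (x \<bullet> \<xi>))) has_derivative (\<lambda>v. - (\<i> * of_real (v \<bullet> \<xi>)))) (at x)"
      by (auto intro!: derivative_eq_intros)
    from has_derivative_compose[OF this DERIV_exp[unfolded has_field_derivative_def]]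
    show ?thesis by (simp add: mult.commute)
  qed
  have int: "integrable lborel (\<lambda>x. g x * ?e x)" if "g \<in> schwartz" for g
    by (rule Bochner_Integration.integrable_bound[OF integrable_schwartz[OF that]])
       (use borel_measurable_continuous_onI[OF continuous_on_schwartz[OF that]] in \<open>auto simp: norm_mult\<close>)
  have D: "?D x b = - (\<i> * of_real (\<xi> \<bullet> b)) * (f x * ?e x) + partial_deriv [b] f x * ?e x" for x
    by (simp add: inner_commute)
  have "(LINT x|lborel. ?D x b) = 0"
  proof (rule integral_directional_derivative_eq_0[where D="?D" and F="\<lambda>x. f x * ?e x" and C="\<bar>\<xi> \<bullet> b\<bar> * C + C'"])
    show "((\<lambda>x. f x * ?e x) has_derivative ?D x) (at x)" for x
      by (rule has_derivative_mult[OF schwartz_has_derivative[OF f] e])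
    show "continuous_on UNIV (\<lambda>x. ?D x b)"
      unfolding D by (intro continuous_intros continuous_on_schwartz f f')
    show "norm (?D x b) \<le> (\<bar>\<xi> \<bullet> b\<bar> * C + C') / (1 + norm x) ^ (2 * DIM('a))" for x
    proof -
      have "norm (?D x b) \<le> \<bar>\<xi> \<bullet> b\<bar> * norm (f x) + norm (partial_deriv [b] f x)"
        unfolding D by (rule order_trans[OF norm_triangle_ineq]) (simp add: norm_mult)
      also have "\<dots> \<le> \<bar>\<xi> \<bullet> b\<bar> * (C / (1 + norm x) ^ (2 * DIM('a))) + C' / (1 + norm x) ^ (2 * DIM('a))"
        using C C' by (intro add_mono mult_left_mono) auto
      finally show ?thesis by (simp add: add_divide_distrib)
    qed
  qed (use b C C' int[OF f] in auto)
  moreover have "(LINT x|lborel. ?D x b) = - (\<i> * of_real (\<xi> \<bullet> b)) * fourier f \<xi> + fourier (partial_deriv [b] f) \<xi>"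
    unfolding D fourier_def
    by (subst Bochner_Integration.integral_add)
       (auto intro!: integrable_mult_right int f f' simp del: partial_deriv.simps)
  ultimately show ?thesis by (simp add: algebra_simps)
qed

text \<open>
  Each derivative along \<open>b\<close> contributes a factor \<open>\<xi>\<^sub>b\<close> to the transform, so all powers of coordinates times
  the transform are bounded; the norm of \<open>\<xi>\<close> is at most \<open>d\<close> times its largest coordinate.
\<close>

lemma fourier_schwartz_bound:
  fixes f :: "'a::euclidean_space \<Rightarrow> complex"
  assumes f: "f \<in> schwartz"
  shows "\<exists>C\<ge>0. \<forall>\<xi>. norm (fourier f \<xi>) \<le> C / (1 + norm \<xi>) ^ N"
proof -
  have coord: "\<exists>C\<ge>0. \<forall>\<xi>. \<bar>\<xi> \<bullet> b\<bar> ^ k * norm (fourier g \<xi>) \<le> C"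
    if b: "b \<in> Basis" and g: "g \<in> schwartz" for b k and g :: "'a \<Rightarrow> complex"
    using g
  proof (induction k arbitrary: g)
    case 0
    show ?case by (intro exI[of _ "LINT x|lborel. norm (g x)"]) (auto simp: norm_fourier_le)
  next
    case (Suc k)
    obtain C where "C \<ge> 0" "\<And>\<xi>. \<bar>\<xi> \<bullet> b\<bar> ^ k * norm (fourier (partial_deriv [b] g) \<xi>) \<le> C"
      using Suc.IH[OF schwartz_partial_deriv[OF Suc.prems b]] by blast
    then show ?case
      unfolding fourier_partial_deriv[OF Suc.prems b] by (auto simp: norm_mult mult_ac)
  qed
  obtain C0 where C0: "C0 \<ge> 0" "\<And>\<xi>. norm (fourier f \<xi>) \<le> C0"
    using coord[OF SOME_Basis f, of 0] by auto
  have "\<forall>b\<in>Basis. \<exists>C\<ge>0. \<forall>\<xi>. \<bar>\<xi> \<bullet> b\<bar> ^ N * norm (fourier f \<xi>) \<le> C"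
    using coord[OF _ f] by blast
  then obtain C where C: "\<And>b. b \<in> Basis \<Longrightarrow> C b \<ge> 0"
    "\<And>b \<xi>. b \<in> Basis \<Longrightarrow> \<bar>\<xi> \<bullet> b\<bar> ^ N * norm (fourier f \<xi>) \<le> C b" by metis
  define A where "A = C0 + (\<Sum>b\<in>Basis. C b)"
  have A: "C0 \<le> A" "\<And>b. b \<in> Basis \<Longrightarrow> C b \<le> A"
    using C(1) C0 member_le_sum[of _ Basis C] by (auto simp: A_def intro!: sum_nonneg add_increasing)
  let ?d = "real (DIM('a)) + 1"
  have "norm (fourier f \<xi>) \<le> (?d ^ N * A) / (1 + norm \<xi>) ^ N" for \<xi>
  proof -
    \<comment> \<open>\<open>r\<close> is the size of a coordinate comparable to the norm of \<open>\<xi>\<close>, or \<open>1\<close> for small \<open>\<xi>\<close>.\<close>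
    obtain r where r: "0 \<le> r" "r ^ N * norm (fourier f \<xi>) \<le> A" "1 + norm \<xi> \<le> ?d * r"
    proof (cases "\<exists>b\<in>Basis. 1 \<le> \<bar>\<xi> \<bullet> b\<bar> \<and> norm \<xi> \<le> real DIM('a) * \<bar>\<xi> \<bullet> b\<bar>")
      case True
      then obtain b where "b \<in> Basis" "1 \<le> \<bar>\<xi> \<bullet> b\<bar>" "norm \<xi> \<le> real DIM('a) * \<bar>\<xi> \<bullet> b\<bar>" by blast
      then show ?thesis using that[of "\<bar>\<xi> \<bullet> b\<bar>"] C(2)[of b \<xi>] A(2)[of b] by (auto simp: algebra_simps)
    next
      case False
      obtain b where b: "b \<in> Basis" "\<And>c. c \<in> Basis \<Longrightarrow> \<bar>\<xi> \<bullet> c\<bar> \<le> \<bar>\<xi> \<bullet> b\<bar>"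
        using obtains_MAX[of Basis "\<lambda>b. \<bar>\<xi> \<bullet> b\<bar>"] Max_ge[of "(\<lambda>b. \<bar>\<xi> \<bullet> b\<bar>) ` Basis"]
        by (metis finite_Basis finite_imageI imageI nonempty_Basis)
      have le: "norm \<xi> \<le> real DIM('a) * \<bar>\<xi> \<bullet> b\<bar>"
        using norm_le_l1[of \<xi>] sum_bounded_above[of Basis "\<lambda>c. \<bar>\<xi> \<bullet> c\<bar>" "\<bar>\<xi> \<bullet> b\<bar>"] b by simp
      then have "\<bar>\<xi> \<bullet> b\<bar> \<le> 1" using False b by force
      then have "norm \<xi> \<le> real DIM('a)" using order_trans[OF le mult_left_le] by simp
      then show ?thesis using that[of 1] C0(2)[of \<xi>] A(1) by simp
    qed
    have "(1 + norm \<xi>) ^ N * norm (fourier f \<xi>) \<le> (?d * r) ^ N * norm (fourier f \<xi>)"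
      using r by (intro mult_right_mono power_mono) auto
    also have "\<dots> \<le> ?d ^ N * A"
      using mult_left_mono[OF r(2), of "?d ^ N"] by (simp add: power_mult_distrib mult.assoc)
    finally have "(1 + norm \<xi>) ^ N * norm (fourier f \<xi>) \<le> ?d ^ N * A" .
    moreover have "0 < (1 + norm \<xi>) ^ N" by (intro zero_less_power add_pos_nonneg) auto
    ultimately show ?thesis by (simp add: field_simps)
  qed
  moreover have "0 \<le> ?d ^ N * A" using A(1) C0(1) by simp
  ultimately show ?thesis by blast
qed

section \<open>The Gaussian as a test function\<close>

lemma real_polynomial_function_has_derivative:
  fixes q :: "'a::real_normed_vector \<Rightarrow> real"
  assumes "real_polynomial_function q"
  shows "\<exists>q'. (\<forall>v. real_polynomial_function (\<lambda>x. q' x v)) \<and> (\<forall>x. (q has_derivative q' x) (at x))"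
  using assms
proof (induction q rule: real_polynomial_function.induct)
  case (linear f)
  then show ?case
    by (intro exI[of _ "\<lambda>x. f"]) (auto intro: bounded_linear_imp_has_derivative)
next
  case (const c)
  then show ?case by (intro exI[of _ "\<lambda>x v. 0"]) auto
next
  case (add f g)
  then obtain f' g' where "\<forall>v. real_polynomial_function (\<lambda>x. f' x v)" "\<forall>x. (f has_derivative f' x) (at x)"
    "\<forall>v. real_polynomial_function (\<lambda>x. g' x v)" "\<forall>x. (g has_derivative g' x) (at x)" by blast
  then show ?case
    by (intro exI[of _ "\<lambda>x v. f' x v + g' x v"]) (auto intro!: has_derivative_add)
next
  case (mult f g)
  then obtain f' g' where "\<forall>v. real_polynomial_function (\<lambda>x. f' x v)" "\<forall>x. (f has_derivative f' x) (at x)"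
    "\<forall>v. real_polynomial_function (\<lambda>x. g' x v)" "\<forall>x. (g has_derivative g' x) (at x)" by blast
  then show ?case using mult.hyps
    by (intro exI[of _ "\<lambda>x v. f x * g' x v + f' x v * g x"])
       (auto intro!: has_derivative_mult real_polynomial_function.intros(3,4))
qed

lemma real_polynomial_function_bound:
  fixes q :: "'a::real_normed_vector \<Rightarrow> real"
  assumes "real_polynomial_function q"
  shows "\<exists>C\<ge>0. \<exists>N. \<forall>x. \<bar>q x\<bar> \<le> C * (1 + norm x) ^ N"
  using assms
proof (induction q rule: real_polynomial_function.induct)
  case (linear f)
  then obtain K where K: "K > 0" "\<And>x. norm (f x) \<le> norm x * K" using bounded_linear.pos_bounded by blast
  have "\<bar>f x\<bar> \<le> K * (1 + norm x) ^ 1" for x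
  proof -
    have "\<bar>f x\<bar> \<le> norm x * K" using K(2)[of x] by simp
    also have "\<dots> \<le> K * (1 + norm x)" using K(1) by (simp add: algebra_simps)
    finally show ?thesis by simp
  qed
  then show ?case using K(1) less_imp_le by blast
next
  case (const c)
  have "\<bar>c\<bar> \<le> \<bar>c\<bar> * (1 + norm x) ^ 0" for x :: 'a by simp
  then show ?case by (meson abs_ge_zero)
next
  case (add f g)
  then obtain C N C' N' where *: "C \<ge> 0" "\<And>x. \<bar>f x\<bar> \<le> C * (1 + norm x) ^ N"
    "C' \<ge> 0" "\<And>x. \<bar>g x\<bar> \<le> C' * (1 + norm x) ^ N'" by blast
  have "\<bar>f x + g x\<bar> \<le> (C + C') * (1 + norm x) ^ (N + N')" for x
  proof -
    have "C * (1 + norm x) ^ N \<le> C * (1 + norm x) ^ (N + N')"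
      "C' * (1 + norm x) ^ N' \<le> C' * (1 + norm x) ^ (N + N')"
      using * by (auto intro!: mult_left_mono power_increasing)
    then show ?thesis using *(2)[of x] *(4)[of x] unfolding distrib_right by linarith
  qed
  then show ?case using * by (intro exI[of _ "C + C'"]) auto
next
  case (mult f g)
  then obtain C N C' N' where *: "C \<ge> 0" "\<And>x. \<bar>f x\<bar> \<le> C * (1 + norm x) ^ N"
    "C' \<ge> 0" "\<And>x. \<bar>g x\<bar> \<le> C' * (1 + norm x) ^ N'" by blast
  have "\<bar>f x * g x\<bar> \<le> (C * C') * (1 + norm x) ^ (N + N')" for x
  proof -
    have "\<bar>f x * g x\<bar> \<le> (C * (1 + norm x) ^ N) * (C' * (1 + norm x) ^ N')"
      unfolding abs_mult using * by (intro mult_mono) auto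
    then show ?thesis by (simp add: power_add mult_ac)
  qed
  then show ?case using * by (intro exI[of _ "C * C'"]) auto
qed

lemma gaussian_rapid_decay: "\<exists>C\<ge>0. \<forall>x::'a::euclidean_space. (1 + norm x) ^ N * gaussian 1 x \<le> C"
proof (cases "N = 0")
  case True
  then show ?thesis by (intro exI[of _ 1]) auto
next
  case False
  have "(1 + norm x) ^ N * gaussian 1 x \<le> real N ^ N * exp (3 / 2)" for x :: 'a
  proof -
    have "((1 + norm x) / real N) ^ N \<le> (1 + (1 + norm x) / real N) ^ N"
      by (intro power_mono) auto
    also have "\<dots> \<le> exp (1 + norm x)"
      using False by (intro exp_ge_one_plus_x_over_n_power_n) (auto intro: order_trans[of _ 0])
    finally have "(1 + norm x) ^ N \<le> real N ^ N * exp (1 + norm x)"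
      using False by (simp add: power_divide field_simps)
    then have "(1 + norm x) ^ N * gaussian 1 x \<le> real N ^ N * exp (1 + norm x) * gaussian 1 x"
      by (intro mult_right_mono) auto
    also have "\<dots> = real N ^ N * exp (1 + norm x - (norm x)\<^sup>2 / 2)"
      by (simp add: gaussian_def mult.assoc flip: exp_add)
    also have "\<dots> \<le> real N ^ N * exp (3 / 2)"
    proof -
      have "0 \<le> (norm x - 1)\<^sup>2" by simp
      then have "1 + norm x - (norm x)\<^sup>2 / 2 \<le> 3 / 2" by (simp add: power2_diff)
      then show ?thesis by (intro mult_left_mono) auto
    qed
    finally show ?thesis .
  qed
  then show ?thesis by (intro exI[of _ "real N ^ N * exp (3 / 2)"]) auto
qed

lemma gaussian_has_derivative:
  "(gaussian 1 has_derivative (\<lambda>v. - (x \<bullet> v) * gaussian 1 x)) (at (x::'a::euclidean_space))"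
  unfolding gaussian_def[abs_def] power2_norm_eq_inner
  by (auto intro!: derivative_eq_intros simp: inner_commute)

text \<open>
  For each derivative one polynomial serves for all multiples of the Gaussian, so a single constant later scales all its
  derivatives at once.
\<close>

lemma partial_deriv_gaussian:
  assumes "set bs \<subseteq> (Basis :: 'a::euclidean_space set)"
  shows "\<exists>q. real_polynomial_function q \<and>
    (\<forall>c. partial_deriv bs (\<lambda>x. complex_of_real (c * gaussian 1 x)) = (\<lambda>x. of_real (c * (q x * gaussian 1 x))))"
  using assms
proof (induction bs)
  case Nil
  show ?case by (intro exI[of _ "\<lambda>x. 1"]) auto
next
  case (Cons b bs)
  then obtain q where q: "real_polynomial_function q"
    "\<And>c. partial_deriv bs (\<lambda>x. complex_of_real (c * gaussian 1 x)) = (\<lambda>x. of_real (c * (q x * gaussian 1 x)))" by auto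
  obtain q' where q': "\<And>v. real_polynomial_function (\<lambda>x. q' x v)" "\<And>x. (q has_derivative q' x) (at x)"
    using real_polynomial_function_has_derivative[OF q(1)] by blast
  have "((\<lambda>x. complex_of_real (c * (q x * gaussian 1 x))) has_derivative
      (\<lambda>v. of_real (c * (q x * (- (x \<bullet> v) * gaussian 1 x) + q' x v * gaussian 1 x)))) (at x)" for c x
    by (intro has_derivative_of_real has_derivative_mult_right has_derivative_mult q'(2) gaussian_has_derivative)
  note fd = frechet_derivative_at[OF this, symmetric]
  have "q x * (- (x \<bullet> b) * gaussian 1 x) + q' x b * gaussian 1 x
      = (q' x b + (- 1) * ((x \<bullet> b) * q x)) * gaussian 1 x" for x
    by (simp add: algebra_simps)
  then have "partial_deriv (b # bs) (\<lambda>x. complex_of_real (c * gaussian 1 x)) =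
      (\<lambda>x. of_real (c * ((q' x b + (- 1) * ((x \<bullet> b) * q x)) * gaussian 1 x)))" for c
    unfolding partial_deriv.simps q(2) fd by simp
  moreover have "real_polynomial_function (\<lambda>x. q' x b + (- 1) * ((x \<bullet> b) * q x))"
    by (intro real_polynomial_function.intros q' q bounded_linear_inner_left)
  ultimately show ?case by blast
qed

lemma gaussian_in_schwartz: "(\<lambda>x::'a::euclidean_space. complex_of_real (c * gaussian 1 x)) \<in> schwartz"
proof -
  have "partial_deriv bs (\<lambda>x::'a. complex_of_real (c * gaussian 1 x)) differentiable_on UNIV \<and>
     (\<exists>C. \<forall>x. (1 + norm x) ^ N * cmod (partial_deriv bs (\<lambda>x::'a. complex_of_real (c * gaussian 1 x)) x) \<le> C)"
    if bs: "set bs \<subseteq> Basis" for bs :: "'a list" and N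
  proof -
    obtain q where q: "real_polynomial_function q"
      "\<And>c. partial_deriv bs (\<lambda>x. complex_of_real (c * gaussian 1 x)) = (\<lambda>x. of_real (c * (q x * gaussian 1 x)))"
      using partial_deriv_gaussian[OF bs] by auto
    obtain q' where q': "\<And>x. (q has_derivative q' x) (at x)"
      using real_polynomial_function_has_derivative[OF q(1)] by blast
    have "((\<lambda>x. complex_of_real (c * (q x * gaussian 1 x))) has_derivative
        (\<lambda>v. of_real (c * (q x * (- (x \<bullet> v) * gaussian 1 x) + q' x v * gaussian 1 x)))) (at x)" for x
      by (intro has_derivative_of_real has_derivative_mult_right has_derivative_mult q' gaussian_has_derivative)
    then have 1: "partial_deriv bs (\<lambda>x. complex_of_real (c * gaussian 1 x)) differentiable_on UNIV"
      unfolding q(2) differentiable_on_def differentiable_def by auto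
    obtain C K where C: "C \<ge> 0" "\<And>x. \<bar>q x\<bar> \<le> C * (1 + norm x) ^ K"
      using real_polynomial_function_bound[OF q(1)] by blast
    obtain D where D: "\<And>x::'a. (1 + norm x) ^ (N + K) * gaussian 1 x \<le> D" using gaussian_rapid_decay by blast
    have "(1 + norm x) ^ N * cmod (complex_of_real (c * (q x * gaussian 1 x))) \<le> \<bar>c\<bar> * C * D" for x
    proof -
      have "(1 + norm x) ^ N * cmod (complex_of_real (c * (q x * gaussian 1 x)))
          = (\<bar>c\<bar> * ((1 + norm x) ^ N * gaussian 1 x)) * \<bar>q x\<bar>"
        by (simp only: norm_of_real abs_mult abs_of_nonneg gaussian_nonneg mult_ac)
      also have "\<dots> \<le> (\<bar>c\<bar> * ((1 + norm x) ^ N * gaussian 1 x)) * (C * (1 + norm x) ^ K)"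
        by (intro mult_left_mono C) auto
      also have "\<dots> = (\<bar>c\<bar> * C) * ((1 + norm x) ^ (N + K) * gaussian 1 x)" by (simp add: power_add mult_ac)
      also have "\<dots> \<le> (\<bar>c\<bar> * C) * D" using C(1) by (intro mult_left_mono D) auto
      finally show ?thesis .
    qed
    then show ?thesis using 1 unfolding q(2) by blast
  qed
  then show ?thesis unfolding schwartz_def smooth_def by blast
qed

text \<open>
  The test class limits only finitely many weighted derivatives.
\<close>

lemma gaussian_in_test_class:
  "\<exists>c>0. (\<lambda>x::'a::euclidean_space. complex_of_real (c * gaussian 1 x)) \<in> test_class m"
proof -
  define K where "K = (m + 2) * (DIM('a) + 1)"
  have fin: "finite (multi_indices (m + 1) :: 'a list set)"
    unfolding multi_indices_def by (rule finite_lists_length_le) simp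
  have "\<exists>D\<ge>0. \<forall>c>0. \<forall>x::'a. (1 + norm x) ^ K * cmod (partial_deriv bs (\<lambda>x. complex_of_real (c * gaussian 1 x)) x) \<le> c * D"
    if "bs \<in> multi_indices (m + 1)" for bs :: "'a list"
  proof -
    have "set bs \<subseteq> Basis" using that by (simp add: multi_indices_def)
    then obtain q where q: "real_polynomial_function q"
      "\<And>c. partial_deriv bs (\<lambda>x. complex_of_real (c * gaussian 1 x)) = (\<lambda>x. of_real (c * (q x * gaussian 1 x)))"
      using partial_deriv_gaussian by blast
    have "(\<lambda>x. complex_of_real (1 * gaussian 1 x)) \<in> schwartz" by (rule gaussian_in_schwartz)
    then obtain D where D: "\<And>x. (1 + norm x) ^ K * cmod (partial_deriv bs (\<lambda>x. complex_of_real (1 * gaussian 1 x)) x) \<le> D"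
      using \<open>set bs \<subseteq> Basis\<close> unfolding schwartz_def by blast
    have "(1 + norm x) ^ K * cmod (partial_deriv bs (\<lambda>x. complex_of_real (c * gaussian 1 x)) x) \<le> c * D" if "c > 0" for c x
      using mult_left_mono[OF D[of x], of c] that unfolding q(2) by (simp add: norm_mult mult_ac)
    moreover have "0 \<le> D" using order_trans[OF _ D[of 0]] by simp
    ultimately show ?thesis by blast
  qed
  then obtain D where D: "\<And>bs. bs \<in> multi_indices (m + 1) \<Longrightarrow> D bs \<ge> 0"
    "\<And>bs c x. bs \<in> multi_indices (m + 1) \<Longrightarrow> c > 0 \<Longrightarrow>
      (1 + norm x) ^ K * cmod (partial_deriv bs (\<lambda>x::'a. complex_of_real (c * gaussian 1 x)) x) \<le> c * D bs"
    by metis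
  define S where "S = 1 + sum D (multi_indices (m + 1))"
  have S: "S > 0" "\<And>bs. bs \<in> multi_indices (m + 1) \<Longrightarrow> D bs \<le> S"
    using D(1) fin by (auto simp: S_def sum_nonneg intro!: add_pos_nonneg add_increasing member_le_sum)
  show ?thesis
  proof (intro exI[of _ "1 / S"] conjI)
    show "(\<lambda>x::'a. complex_of_real (1 / S * gaussian 1 x)) \<in> test_class m"
      unfolding test_class_def mem_Collect_eq K_def[symmetric]
    proof (intro conjI allI ballI)
      fix x :: 'a and bs :: "'a list" assume bs: "bs \<in> multi_indices (m + 1)"
      have "(1 + norm x) ^ K * cmod (partial_deriv bs (\<lambda>x. complex_of_real (1 / S * gaussian 1 x)) x) \<le> 1 / S * D bs"
        by (rule D(2)[OF bs]) (use S(1) in simp)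
      also have "\<dots> \<le> 1" using S(1) S(2)[OF bs] by simp
      finally show "(1 + norm x) ^ K * cmod (partial_deriv bs (\<lambda>x. complex_of_real (1 / S * gaussian 1 x)) x) \<le> 1" .
    qed (rule gaussian_in_schwartz)
  qed (use S in auto)
qed

section \<open>Superlevel sets of the maximal function\<close>

text \<open>
  The condition \<open>y \<in> ball x t\<close> is symmetric in \<open>x\<close> and \<open>y\<close>, so a superlevel set is a union of balls.
\<close>

lemma open_maximal_fun_superlevel: "open {x. a < maximal_fun scales m g x}"
proof -
  have "{x. a < maximal_fun scales m g x} = (\<Union>\<phi>\<in>test_class m. \<Union>t\<in>scales.
      \<Union>y\<in>{y. a < ennreal (cmod (distr_conv g (dilate t \<phi>) y))}. ball y t)"
    by (intro set_eqI, simp add: maximal_fun_def less_SUP_iff Bex_def dist_commute, blast?)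
  then show ?thesis by auto
qed

lemma borel_measurable_maximal_fun: "maximal_fun scales m g \<in> borel_measurable borel"
  by (rule borel_measurableI_greater) (use borel_open[OF open_maximal_fun_superlevel] in auto)

definition level_measure :: "('a::euclidean_space \<Rightarrow> ennreal) \<Rightarrow> int \<Rightarrow> real" where
  "level_measure W n = measure lborel {x. ennreal (2 powr real_of_int n) < W x}"

text \<open>
  If \<open>2\<^sup>n < G(x) \<le> 2\<^sup>n\<^sup>+\<^sup>1\<close> then \<open>W > 2\<^sup>n\<close> on the whole ball of radius \<open>t\<close> about \<open>x\<close>. So \<open>x\<close> lies in the
  superlevel set of \<open>W\<close> at \<open>2\<^sup>n\<close>, and that set has at least the measure of the ball, which is the
  condition on \<open>n\<close> in the sum. The sum of squares that results is at most the square of the sum.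
\<close>

lemma nn_integral_power2_le_level_sum:
  fixes W :: "'a::euclidean_space \<Rightarrow> ennreal" and G :: "'a \<Rightarrow> real"
  assumes [measurable]: "W \<in> borel_measurable borel"
    and fin: "\<And>n::int. emeasure lborel {x. ennreal (2 powr real_of_int n) < W x} < \<infinity>"
    and G: "\<And>x. 0 \<le> G x" "\<And>x y. dist x y < t \<Longrightarrow> ennreal (G y) \<le> W x" and t: "0 < t"
  shows "(\<integral>\<^sup>+x. ennreal ((G x)\<^sup>2) \<partial>lborel) \<le>
    (\<integral>\<^sup>+n. ennreal (2 * 2 powr real_of_int n * sqrt (level_measure W n)) *
       indicator {n. unit_ball_vol (real DIM('a)) * t ^ DIM('a) \<le> level_measure W n} n \<partial>count_space UNIV)\<^sup>2"
    (is "_ \<le> (\<integral>\<^sup>+n. ?a n \<partial>_)\<^sup>2")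
proof -
  let ?E = "\<lambda>n::int. {x. ennreal (2 powr real_of_int n) < W x}"
  let ?N = "{n. unit_ball_vol (real DIM('a)) * t ^ DIM('a) \<le> level_measure W n}"
  have emeas: "emeasure lborel (?E n) = ennreal (level_measure W n)" for n
    unfolding level_measure_def using fin[of n] by (intro emeasure_eq_ennreal_measure) auto
  have point: "ennreal ((G x)\<^sup>2) \<le> (\<integral>\<^sup>+n. ennreal ((2 * 2 powr real_of_int n)\<^sup>2) * indicator ?N n * indicator (?E n) x \<partial>count_space UNIV)" for x
  proof (cases "G x = 0")
    case False
    then have pos: "0 < G x" using G(1)[of x] by simp
    \<comment> \<open>The largest \<open>n\<close> with \<open>2 powr n < G x\<close>, so that \<open>G x\<close> is at most twice that power.\<close>
    define n where "n = \<lceil>log 2 (G x)\<rceil> - 1"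
    have "real_of_int n < log 2 (G x)" "log 2 (G x) \<le> real_of_int n + 1"
      unfolding n_def by linarith+
    then have n: "2 powr real_of_int n < G x" "G x \<le> 2 * 2 powr real_of_int n"
      using pos by (auto simp: less_log_iff log_le_iff powr_add mult.commute)
    have sub: "ball x t \<subseteq> ?E n"
    proof
      fix y assume "y \<in> ball x t"
      then have "ennreal (G x) \<le> W y" by (intro G(2)) (simp add: dist_commute)
      moreover have "ennreal (2 powr real_of_int n) < ennreal (G x)" using n(1) pos by (intro ennreal_lessI)
      ultimately show "y \<in> ?E n" by simp
    qed
    have "ennreal (unit_ball_vol (real DIM('a)) * t ^ DIM('a)) = emeasure lborel (ball x t)"
      using t by (simp add: emeasure_ball)
    also have "\<dots> \<le> emeasure lborel (?E n)" using sub by (intro emeasure_mono) auto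
    finally have "unit_ball_vol (real DIM('a)) * t ^ DIM('a) \<le> level_measure W n"
      by (simp add: emeas level_measure_def)
    then have nN: "n \<in> ?N" by simp
    have xE: "x \<in> ?E n" using subsetD[OF sub, of x] t by simp
    have "ennreal ((G x)\<^sup>2) \<le> ennreal ((2 * 2 powr real_of_int n)\<^sup>2) * indicator ?N n * indicator (?E n) x"
      using nN xE ennreal_leI[OF power_mono[OF n(2) G(1)], of 2] by (simp only: indicator_simps mult_1_right)
    also have "\<dots> \<le> (\<integral>\<^sup>+n. ennreal ((2 * 2 powr real_of_int n)\<^sup>2) * indicator ?N n * indicator (?E n) x \<partial>count_space UNIV)"
      by (rule nn_integral_ge_point[where p="\<lambda>n. ennreal ((2 * 2 powr real_of_int n)\<^sup>2) * indicator ?N n * indicator (?E n) x"]) simp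
    finally show ?thesis .
  qed simp
  have "(\<integral>\<^sup>+x. ennreal ((G x)\<^sup>2) \<partial>lborel)
      \<le> (\<integral>\<^sup>+x. \<integral>\<^sup>+n. ennreal ((2 * 2 powr real_of_int n)\<^sup>2) * indicator ?N n * indicator (?E n) x \<partial>count_space UNIV \<partial>lborel)"
    by (intro nn_integral_mono point)
  also have "\<dots> = (\<integral>\<^sup>+n. \<integral>\<^sup>+x. ennreal ((2 * 2 powr real_of_int n)\<^sup>2) * indicator ?N n * indicator (?E n) x \<partial>lborel \<partial>count_space UNIV)"
    by (rule nn_integral_count_space_nn_integral) auto
  also have "\<dots> = (\<integral>\<^sup>+n. (?a n)\<^sup>2 \<partial>count_space UNIV)"
  proof (rule nn_integral_cong)
    fix n :: int
    have "(\<integral>\<^sup>+x. ennreal ((2 * 2 powr real_of_int n)\<^sup>2) * indicator ?N n * indicator (?E n) x \<partial>lborel)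
      = ennreal ((2 * 2 powr real_of_int n)\<^sup>2) * indicator ?N n * ennreal (level_measure W n)"
      by (subst nn_integral_cmult_indicator) (auto simp: emeas)
    also have "\<dots> = (?a n)\<^sup>2"
    proof -
      have "0 \<le> level_measure W n" by (simp add: level_measure_def)
      then have "(2 * 2 powr real_of_int n)\<^sup>2 * level_measure W n = (2 * 2 powr real_of_int n * sqrt (level_measure W n))\<^sup>2"
        by (simp add: power_mult_distrib)
      then have "ennreal ((2 * 2 powr real_of_int n)\<^sup>2) * ennreal (level_measure W n)
          = (ennreal (2 * 2 powr real_of_int n * sqrt (level_measure W n)))\<^sup>2"
        using \<open>0 \<le> level_measure W n\<close> by (simp add: ennreal_power ennreal_mult'[symmetric])
      then show ?thesis by (auto simp: indicator_def)
    qed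
    finally show "(\<integral>\<^sup>+x. ennreal ((2 * 2 powr real_of_int n)\<^sup>2) * indicator ?N n * indicator (?E n) x \<partial>lborel) = (?a n)\<^sup>2" .
  qed
  also have "\<dots> \<le> (\<integral>\<^sup>+n. ?a n * (\<integral>\<^sup>+k. ?a k \<partial>count_space UNIV) \<partial>count_space UNIV)"
    unfolding power2_eq_square
    by (intro nn_integral_mono mult_left_mono nn_integral_ge_point) auto
  also have "\<dots> = (\<integral>\<^sup>+n. ?a n \<partial>count_space UNIV)\<^sup>2"
    by (simp add: nn_integral_multc power2_eq_square)
  finally show ?thesis .
qed

lemma extend_ennreal_gt:
  assumes "growth_function p \<Psi>" "ennreal s < w" "0 \<le> s"
  shows "ennreal (\<Psi> s) \<le> extend_ennreal \<Psi> w"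
proof (cases w)
  case (real r)
  then have "s < r" using assms by (simp add: ennreal_less_iff)
  then show ?thesis using real assms growth_function_less_iff[OF assms(1), of s r]
    by (simp add: extend_ennreal_def ennreal_leI)
qed (simp add: extend_ennreal_def)

lemma level_measure_chebyshev:
  fixes W :: "'a::euclidean_space \<Rightarrow> ennreal"
  assumes \<Psi>: "growth_function p \<Psi>" and [measurable]: "W \<in> borel_measurable borel"
    and mod: "modular \<Psi> W \<le> 1"
  shows "emeasure lborel {x. ennreal (2 powr real_of_int n) < W x} < \<infinity>"
    and "\<Psi> (2 powr real_of_int n) * level_measure W n \<le> 1"
proof -
  let ?E = "{x. ennreal (2 powr real_of_int n) < W x}"
  have pos: "0 < \<Psi> (2 powr real_of_int n)" by (intro growth_function_pos[OF \<Psi>]) simp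
  have "ennreal (\<Psi> (2 powr real_of_int n)) * emeasure lborel ?E
      = (\<integral>\<^sup>+x. ennreal (\<Psi> (2 powr real_of_int n)) * indicator ?E x \<partial>lborel)"
    by (subst nn_integral_cmult_indicator) auto
  also have "\<dots> \<le> modular \<Psi> W"
    unfolding modular_def
    by (intro nn_integral_mono) (auto simp: indicator_def intro!: extend_ennreal_gt[OF \<Psi>])
  finally have *: "ennreal (\<Psi> (2 powr real_of_int n)) * emeasure lborel ?E \<le> 1" using mod by simp
  show fin: "emeasure lborel ?E < \<infinity>"
  proof -
    have "ennreal (\<Psi> (2 powr real_of_int n)) * emeasure lborel ?E < top"
      using * by (rule le_less_trans) simp
    then show ?thesis using pos by (auto simp: ennreal_mult_less_top)
  qed
  have "emeasure lborel ?E = ennreal (level_measure W n)"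
    unfolding level_measure_def using fin by (intro emeasure_eq_ennreal_measure) auto
  then show "\<Psi> (2 powr real_of_int n) * level_measure W n \<le> 1"
    using * pos by (simp add: ennreal_mult'[symmetric] less_imp_le)
qed

text \<open>
  After exchanging sum and integral, the sum at \<open>x\<close> runs over the powers \<open>2\<^sup>n < W(x)\<close> and is comparable
  to \<open>\<Psi>(W(x))\<close>.
\<close>

lemma sum_growth_level_measure_le:
  assumes \<Psi>: "growth_function p \<Psi>"
  shows "\<exists>C>0. \<forall>W::'a::euclidean_space \<Rightarrow> ennreal. W \<in> borel_measurable borel \<longrightarrow> modular \<Psi> W \<le> 1 \<longrightarrow>
    (\<integral>\<^sup>+n. ennreal (\<Psi> (2 powr real_of_int n) * level_measure W n) \<partial>count_space UNIV) \<le> ennreal C"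
proof -
  have "mono_on {0..} \<Psi>"
    using growth_function_le_iff[OF \<Psi>] by (auto intro!: mono_onI)
  moreover have "0 < p" "lower_type p \<Psi>" using \<Psi> by (auto simp: growth_function_def)
  ultimately obtain C where C: "C > 0"
    "\<And>w. w > 0 \<Longrightarrow> (\<integral>\<^sup>+n. ennreal (\<Psi> (2 powr real_of_int n)) *
            indicator {n. 2 powr real_of_int n \<le> w} n \<partial>count_space UNIV) \<le> ennreal (C * \<Psi> w)"
    using dyadic_sum_le[of p \<Psi>] growth_function_nonneg[OF \<Psi>] by blast
  show ?thesis
  proof (intro exI[of _ C] conjI allI impI)
    fix W :: "'a \<Rightarrow> ennreal"
    assume [measurable]: "W \<in> borel_measurable borel" and mod: "modular \<Psi> W \<le> 1"
    let ?E = "\<lambda>n::int. {x. ennreal (2 powr real_of_int n) < W x}"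
    have emeas: "emeasure lborel (?E n) = ennreal (level_measure W n)" for n
      unfolding level_measure_def using level_measure_chebyshev(1)[OF \<Psi> _ mod, of n]
      by (intro emeasure_eq_ennreal_measure) auto
    have "(\<integral>\<^sup>+n. ennreal (\<Psi> (2 powr real_of_int n) * level_measure W n) \<partial>count_space UNIV)
      = (\<integral>\<^sup>+n. \<integral>\<^sup>+x. ennreal (\<Psi> (2 powr real_of_int n)) * indicator (?E n) x \<partial>lborel \<partial>count_space UNIV)"
      by (intro nn_integral_cong, subst nn_integral_cmult_indicator)
         (auto simp: emeas ennreal_mult' growth_function_nonneg[OF \<Psi>])
    also have "\<dots> = (\<integral>\<^sup>+x. \<integral>\<^sup>+n. ennreal (\<Psi> (2 powr real_of_int n)) * indicator (?E n) x \<partial>count_space UNIV \<partial>lborel)"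
      by (rule nn_integral_count_space_nn_integral[symmetric]) auto
    also have "\<dots> \<le> (\<integral>\<^sup>+x. ennreal C * extend_ennreal \<Psi> (W x) \<partial>lborel)"
    proof (rule nn_integral_mono)
      fix x
      show "(\<integral>\<^sup>+n. ennreal (\<Psi> (2 powr real_of_int n)) * indicator (?E n) x \<partial>count_space UNIV) \<le> ennreal C * extend_ennreal \<Psi> (W x)"
      proof (cases "W x")
        case (real w)
        show ?thesis
        proof (cases "w = 0")
          case True
          then have "indicator (?E n) x = (0::ennreal)" for n using real by (simp add: indicator_def)
          then show ?thesis by simp
        next
          case False
          then have w: "0 < w" using real by simp
          have "indicator (?E n) x \<le> (indicator {n. 2 powr real_of_int n \<le> w} n :: ennreal)" for n
            using real w by (auto simp: indicator_def ennreal_less_iff)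
          then have "(\<integral>\<^sup>+n. ennreal (\<Psi> (2 powr real_of_int n)) * indicator (?E n) x \<partial>count_space UNIV)
            \<le> (\<integral>\<^sup>+n. ennreal (\<Psi> (2 powr real_of_int n)) * indicator {n. 2 powr real_of_int n \<le> w} n \<partial>count_space UNIV)"
            by (intro nn_integral_mono mult_left_mono) auto
          also have "\<dots> \<le> ennreal (C * \<Psi> w)" by (rule C(2)[OF w])
          also have "\<dots> = ennreal C * extend_ennreal \<Psi> (W x)"
            using real C(1) by (simp add: extend_ennreal_def ennreal_mult')
          finally show ?thesis .
        qed
      next
        case top
        then show ?thesis using C(1) by (simp add: extend_ennreal_def ennreal_mult_top)
      qed
    qed
    also have "\<dots> \<le> ennreal C"
    proof -
      have meas: "(\<lambda>x. extend_ennreal \<Psi> (W x)) \<in> borel_measurable borel"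
      proof -
        have "(\<lambda>t. \<Psi> (max 0 t)) \<in> borel_measurable borel"
        proof (intro borel_measurable_continuous_onI continuous_on_compose2[where g=\<Psi> and f="max 0"])
          show "continuous_on {0..} \<Psi>" using \<Psi> by (simp add: growth_function_def)
        qed (auto intro!: continuous_intros)
        then have [measurable]: "(\<lambda>t. ennreal (\<Psi> (max 0 t))) \<in> borel_measurable borel" by measurable
        have "extend_ennreal \<Psi> (W x) = (if W x = \<infinity> then \<infinity> else ennreal (\<Psi> (max 0 (enn2real (W x)))))" for x
          by (simp add: extend_ennreal_def)
        moreover have "(\<lambda>x. if W x = \<infinity> then \<infinity> else ennreal (\<Psi> (max 0 (enn2real (W x))))) \<in> borel_measurable borel"
          by measurable
        ultimately show ?thesis by simp
      qed
      have "(\<integral>\<^sup>+x. ennreal C * extend_ennreal \<Psi> (W x) \<partial>lborel) = ennreal C * modular \<Psi> W"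
        unfolding modular_def by (rule nn_integral_cmult) (use meas in simp)
      also have "\<dots> \<le> ennreal C * 1" by (intro mult_left_mono mod) simp
      finally show ?thesis by simp
    qed
    finally show "(\<integral>\<^sup>+n. ennreal (\<Psi> (2 powr real_of_int n) * level_measure W n) \<partial>count_space UNIV) \<le> ennreal C" .
  qed (rule C(1))
qed

text \<open>
  The condition on \<open>j\<close> says that \<open>2\<^sup>-\<^sup>j\<close> is at most \<open>(e/v)\<^sup>1\<^sup>/\<^sup>d\<close>, and the summand is the power \<open>d/2\<close> of
  \<open>2\<^sup>-\<^sup>j\<close>: a dyadic sum comparable to \<open>(e/v)\<^sup>1\<^sup>/\<^sup>2\<close>.
\<close>

lemma sum_dyadic_scales_le:
  fixes d :: nat and v :: real
  assumes d: "0 < d" and v: "0 < v"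
  shows "\<exists>C>0. \<forall>e\<ge>0. (\<integral>\<^sup>+j. ennreal (2 powr (- (real_of_int j * real d / 2))) *
     indicator {j. v * (2 powr (- real_of_int j)) ^ d \<le> e} j \<partial>count_space UNIV) \<le> ennreal (C * sqrt e)"
proof -
  let ?\<Phi> = "\<lambda>t::real. t powr (real d / 2)"
  have "lower_type (real d / 2) ?\<Phi>"
    unfolding lower_type_def by (intro exI[of _ 1]) (auto simp: powr_mult)
  moreover have "mono_on {0..} ?\<Phi>" by (auto intro!: mono_onI powr_mono2)
  ultimately obtain C where C: "C > 0"
    "\<And>w. w > 0 \<Longrightarrow> (\<integral>\<^sup>+n. ennreal (?\<Phi> (2 powr real_of_int n)) *
            indicator {n. 2 powr real_of_int n \<le> w} n \<partial>count_space UNIV) \<le> ennreal (C * ?\<Phi> w)"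
    using dyadic_sum_le[of "real d / 2" ?\<Phi>] d by auto
  show ?thesis
  proof (intro exI[of _ "C / sqrt v"] conjI allI impI)
    show "0 < C / sqrt v" using C v by simp
    fix e :: real assume e: "0 \<le> e"
    show "(\<integral>\<^sup>+j. ennreal (2 powr (- (real_of_int j * real d / 2))) *
     indicator {j. v * (2 powr (- real_of_int j)) ^ d \<le> e} j \<partial>count_space UNIV) \<le> ennreal (C / sqrt v * sqrt e)"
    proof (cases "e = 0")
      case True
      have "\<not> v * (2 powr (- real_of_int j)) ^ d \<le> 0" for j :: int
        using v by (simp add: not_le)
      then show ?thesis using True by simp
    next
      case False
      define w where "w = (e / v) powr (1 / real d)"
      have w: "0 < w" using False e v by (simp add: w_def)
      have wd: "w ^ d = e / v" using w False e v d by (simp add: w_def powr_powr powr_realpow[symmetric])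
      have iff: "v * (2 powr (- real_of_int j)) ^ d \<le> e \<longleftrightarrow> 2 powr real_of_int (- j) \<le> w" for j
      proof -
        have "v * (2 powr (- real_of_int j)) ^ d \<le> e \<longleftrightarrow> (2 powr (- real_of_int j)) ^ d \<le> w ^ d"
          using v by (simp add: wd field_simps)
        also have "\<dots> \<longleftrightarrow> 2 powr (- real_of_int j) \<le> w" using w d by (intro power_mono_iff) auto
        finally show ?thesis by simp
      qed
      have "(\<integral>\<^sup>+j. ennreal (2 powr (- (real_of_int j * real d / 2))) *
          indicator {j. v * (2 powr (- real_of_int j)) ^ d \<le> e} j \<partial>count_space UNIV)
        = (\<integral>\<^sup>+j. (\<lambda>n. ennreal (?\<Phi> (2 powr real_of_int n)) * indicator {n. 2 powr real_of_int n \<le> w} n) (- j) \<partial>count_space UNIV)"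
        unfolding iff by (intro nn_integral_cong) (simp add: powr_powr indicator_def)
      also have "\<dots> = (\<integral>\<^sup>+n. ennreal (?\<Phi> (2 powr real_of_int n)) * indicator {n. 2 powr real_of_int n \<le> w} n \<partial>count_space UNIV)"
        by (rule nn_integral_bij_count_space) (auto intro: bij_uminus)
      also have "\<dots> \<le> ennreal (C * ?\<Phi> w)" by (rule C(2)[OF w])
      also have "?\<Phi> w = sqrt (e / v)"
        using e v d by (simp add: w_def powr_powr powr_half_sqrt)
      finally show ?thesis using e v by (simp add: real_sqrt_divide)
    qed
  qed
qed

text \<open>
  The summation behind the Hardy inequality. Here \<open>1 / growth_inv \<Psi> R\<close> with \<open>R = 2\<^sup>j\<^sup>d / v\<close> is the bound
  for the inverse symbol on the shell \<open>j\<close>. In the inner sum \<open>1 / R\<close> is at most the measure of the level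
  set, so Chebyshev gives \<open>\<Psi>(2\<^sup>n) \<le> R\<close> and the bound becomes \<open>\<Psi>(2\<^sup>n) / (2\<^sup>n R)\<close>; the powers of \<open>2\<^sup>n\<close>
  cancel, and the sum over \<open>j\<close> is done first.
\<close>

lemma hardy_sum_le:
  assumes \<Psi>: "growth_function p \<Psi>"
  defines "v \<equiv> unit_ball_vol (real DIM('a::euclidean_space))" and "d \<equiv> DIM('a)"
  shows "\<exists>C>0. \<forall>W::'a \<Rightarrow> ennreal. W \<in> borel_measurable borel \<longrightarrow> modular \<Psi> W \<le> 1 \<longrightarrow>
    (\<integral>\<^sup>+j. ennreal (2 powr (real_of_int j * real d / 2) / growth_inv \<Psi> ((2 powr real_of_int j) ^ d / v)) *
      (\<integral>\<^sup>+n. ennreal (2 * 2 powr real_of_int n * sqrt (level_measure W n)) *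
        indicator {n. v * (2 powr (- real_of_int j)) ^ d \<le> level_measure W n} n \<partial>count_space UNIV)
      \<partial>count_space UNIV) \<le> ennreal C"
proof -
  have v: "0 < v" by (simp add: v_def)
  have d: "0 < d" by (simp add: d_def)
  obtain C1 where C1: "C1 > 0" "\<And>e. e \<ge> 0 \<Longrightarrow> (\<integral>\<^sup>+j. ennreal (2 powr (- (real_of_int j * real d / 2))) *
     indicator {j. v * (2 powr (- real_of_int j)) ^ d \<le> e} j \<partial>count_space UNIV) \<le> ennreal (C1 * sqrt e)"
    using sum_dyadic_scales_le[OF d v] by blast
  obtain C2 where C2: "C2 > 0" "\<And>W::'a \<Rightarrow> ennreal. W \<in> borel_measurable borel \<Longrightarrow> modular \<Psi> W \<le> 1 \<Longrightarrow>
    (\<integral>\<^sup>+n. ennreal (\<Psi> (2 powr real_of_int n) * level_measure W n) \<partial>count_space UNIV) \<le> ennreal C2"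
    using sum_growth_level_measure_le[OF \<Psi>] by blast
  show ?thesis
  proof (intro exI[of _ "2 * v * C1 * C2"] conjI allI impI)
    show "0 < 2 * v * C1 * C2" using v C1 C2 by simp
    fix W :: "'a \<Rightarrow> ennreal"
    assume W: "W \<in> borel_measurable borel" and mod: "modular \<Psi> W \<le> 1"
    let ?e = "level_measure W"
    let ?N = "\<lambda>j. {n. v * (2 powr (- real_of_int j)) ^ d \<le> ?e n}"
    have e0: "0 \<le> ?e n" for n by (simp add: level_measure_def)
    have \<Psi>0: "0 \<le> \<Psi> (2 powr real_of_int n)" for n by (intro growth_function_nonneg[OF \<Psi>]) simp
    let ?b = "\<lambda>j n. ennreal (2 * v * \<Psi> (2 powr real_of_int n) * sqrt (?e n)) *
        (ennreal (2 powr (- (real_of_int j * real d / 2))) * indicator {j. v * (2 powr (- real_of_int j)) ^ d \<le> ?e n} j)"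
    have step: "ennreal (2 powr (real_of_int j * real d / 2) / growth_inv \<Psi> ((2 powr real_of_int j) ^ d / v)) *
        (ennreal (2 * 2 powr real_of_int n * sqrt (?e n)) * indicator (?N j) n) \<le> ?b j n" for j n
    proof (cases "n \<in> ?N j")
      case True
      define R where "R = (2 powr real_of_int j) ^ d / v"
      have R: "0 < R" using v by (simp add: R_def)
      have inv: "v * (2 powr (- real_of_int j)) ^ d = 1 / R"
        using v by (simp add: R_def powr_minus field_simps)
      have "\<Psi> (2 powr real_of_int n) * (1 / R) \<le> \<Psi> (2 powr real_of_int n) * ?e n"
        using True unfolding inv by (intro mult_left_mono \<Psi>0) simp
      also have "\<dots> \<le> 1" by (rule level_measure_chebyshev(2)[OF \<Psi> W mod])
      finally have "\<Psi> (2 powr real_of_int n) \<le> R" using R by (simp add: field_simps)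
      then have le: "1 / growth_inv \<Psi> R \<le> \<Psi> (2 powr real_of_int n) / (2 powr real_of_int n * R)"
        by (intro inverse_growth_inv_le[OF \<Psi>]) auto
      have RR: "2 powr (real_of_int j * real d / 2) / R = v * 2 powr (- (real_of_int j * real d / 2))"
      proof -
        have "(2 powr real_of_int j) ^ d = 2 powr (real_of_int j * real d / 2) * 2 powr (real_of_int j * real d / 2)"
          by (simp add: powr_powr powr_add[symmetric] flip: powr_realpow)
        then show ?thesis using v by (simp add: R_def powr_minus field_simps)
      qed
      have "2 powr (real_of_int j * real d / 2) / growth_inv \<Psi> R * (2 * 2 powr real_of_int n * sqrt (?e n))
          = 2 powr (real_of_int j * real d / 2) * (2 * 2 powr real_of_int n * sqrt (?e n)) * (1 / growth_inv \<Psi> R)"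
        by simp
      also have "\<dots> \<le> 2 powr (real_of_int j * real d / 2) * (2 * 2 powr real_of_int n * sqrt (?e n)) *
          (\<Psi> (2 powr real_of_int n) / (2 powr real_of_int n * R))"
        using e0 by (intro mult_left_mono le) auto
      also have "\<dots> = 2 * \<Psi> (2 powr real_of_int n) * sqrt (?e n) * (2 powr (real_of_int j * real d / 2) / R)"
        by (simp add: field_simps)
      also have "\<dots> = 2 * v * \<Psi> (2 powr real_of_int n) * sqrt (?e n) * 2 powr (- (real_of_int j * real d / 2))"
        unfolding RR by simp
      finally have "2 powr (real_of_int j * real d / 2) / growth_inv \<Psi> R * (2 * 2 powr real_of_int n * sqrt (?e n))
        \<le> 2 * v * \<Psi> (2 powr real_of_int n) * sqrt (?e n) * 2 powr (- (real_of_int j * real d / 2))" .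
      moreover have "0 < growth_inv \<Psi> R" by (rule growth_inv_pos[OF \<Psi> R])
      ultimately have "ennreal (2 powr (real_of_int j * real d / 2) / growth_inv \<Psi> R) * ennreal (2 * 2 powr real_of_int n * sqrt (?e n))
        \<le> ennreal (2 * v * \<Psi> (2 powr real_of_int n) * sqrt (?e n)) * ennreal (2 powr (- (real_of_int j * real d / 2)))"
        using e0[of n] \<Psi>0[of n] v by (simp add: ennreal_mult'[symmetric] ennreal_leI)
      then show ?thesis using True by (simp add: R_def[symmetric])
    qed simp
    have "(\<integral>\<^sup>+j. ennreal (2 powr (real_of_int j * real d / 2) / growth_inv \<Psi> ((2 powr real_of_int j) ^ d / v)) *
      (\<integral>\<^sup>+n. ennreal (2 * 2 powr real_of_int n * sqrt (?e n)) * indicator (?N j) n \<partial>count_space UNIV)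
      \<partial>count_space UNIV) \<le> (\<integral>\<^sup>+j. \<integral>\<^sup>+n. ?b j n \<partial>count_space UNIV \<partial>count_space UNIV)"
      by (subst nn_integral_cmult[symmetric], simp, intro nn_integral_mono step)
    also have "\<dots> = (\<integral>\<^sup>+n. \<integral>\<^sup>+j. ?b j n \<partial>count_space UNIV \<partial>count_space UNIV)"
      by (rule nn_integral_count_space_nn_integral) auto
    also have "\<dots> \<le> (\<integral>\<^sup>+n. ennreal (2 * v * C1) * ennreal (\<Psi> (2 powr real_of_int n) * ?e n) \<partial>count_space UNIV)"
    proof (rule nn_integral_mono)
      fix n :: int
      have "(\<integral>\<^sup>+j. ?b j n \<partial>count_space UNIV) \<le> ennreal (2 * v * \<Psi> (2 powr real_of_int n) * sqrt (?e n)) * ennreal (C1 * sqrt (?e n))"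
        by (subst nn_integral_cmult, simp, intro mult_left_mono C1(2) e0) simp
      also have "\<dots> = ennreal ((2 * v * \<Psi> (2 powr real_of_int n) * sqrt (?e n)) * (C1 * sqrt (?e n)))"
        using v e0[of n] \<Psi>0[of n] by (intro ennreal_mult'[symmetric] mult_nonneg_nonneg) simp_all
      also have "(2 * v * \<Psi> (2 powr real_of_int n) * sqrt (?e n)) * (C1 * sqrt (?e n))
          = (2 * v * C1) * (\<Psi> (2 powr real_of_int n) * (sqrt (?e n) * sqrt (?e n)))" by (simp only: mult_ac)
      also have "ennreal \<dots> = ennreal (2 * v * C1) * ennreal (\<Psi> (2 powr real_of_int n) * ?e n)"
        using e0[of n] v C1(1) by (simp add: ennreal_mult')
      finally show "(\<integral>\<^sup>+j. ?b j n \<partial>count_space UNIV) \<le> ennreal (2 * v * C1) * ennreal (\<Psi> (2 powr real_of_int n) * ?e n)" .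
    qed
    also have "\<dots> = ennreal (2 * v * C1) * (\<integral>\<^sup>+n. ennreal (\<Psi> (2 powr real_of_int n) * ?e n) \<partial>count_space UNIV)"
      by (rule nn_integral_cmult) simp
    also have "\<dots> \<le> ennreal (2 * v * C1) * ennreal C2" by (intro mult_left_mono C2(2) W mod) simp
    also have "\<dots> = ennreal (2 * v * C1 * C2)" using C2(1) by (intro ennreal_mult''[symmetric]) simp
    finally show "(\<integral>\<^sup>+j. ennreal (2 powr (real_of_int j * real d / 2) / growth_inv \<Psi> ((2 powr real_of_int j) ^ d / v)) *
      (\<integral>\<^sup>+n. ennreal (2 * 2 powr real_of_int n * sqrt (?e n)) * indicator (?N j) n \<partial>count_space UNIV)
      \<partial>count_space UNIV) \<le> ennreal (2 * v * C1 * C2)" .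
  qed
qed

section \<open>From frequency shells to the maximal function\<close>

text \<open>
  Needed because the synthesis \<open>\<integral> H(\<xi>) e\<^sup>i\<^sup>x\<^sup>\<xi> d\<xi>\<close> is the Fourier transform of \<open>H\<close> at \<open>-x\<close>.
\<close>

lemma nn_integral_lborel_uminus:
  fixes f :: "'a::euclidean_space \<Rightarrow> ennreal"
  assumes [measurable]: "f \<in> borel_measurable borel"
  shows "(\<integral>\<^sup>+x. f (- x) \<partial>lborel) = (\<integral>\<^sup>+x. f x \<partial>lborel)"
proof -
  have "(lborel :: 'a measure) = distr lborel borel uminus"
    using lborel_affine[of "-1" "0::'a"] by (simp add: density_1)
  then have "(\<integral>\<^sup>+x. f x \<partial>lborel) = (\<integral>\<^sup>+x. f x \<partial>distr lborel borel uminus)" by simp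
  then show ?thesis by (simp add: nn_integral_distr)
qed

text \<open>
  Convolution with a Gaussian multiplies on the frequency side. The distribution is given by the
  inverse transform of a multiple of \<open>H\<close>, so this is \<open>integral_fourier_gaussian\<close> after a
  translation by \<open>y\<close>.
\<close>

lemma distr_conv_gaussian:
  fixes H :: "'a::euclidean_space \<Rightarrow> complex"
  assumes H: "integrable lborel H" and t: "0 < t"
  shows "distr_conv (distr_of_fun (\<lambda>x. of_real k * fourier H (- x))) (dilate t (\<lambda>x. of_real (c * gaussian 1 x))) y
    = of_real (k * c * sqrt (2 * pi) ^ DIM('a)) * fourier (\<lambda>\<xi>. H \<xi> * of_real (gaussian (t\<^sup>2) \<xi>)) (- y)"
proof -
  let ?s = "1 / t\<^sup>2" and ?u = "\<lambda>\<xi>. H \<xi> * exp (\<i> * of_real (y \<bullet> \<xi>))"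
  have u: "integrable lborel ?u"
    by (rule Bochner_Integration.integrable_bound[OF H])
       (use borel_measurable_integrable[OF H] in \<open>auto simp: norm_mult\<close>)
  have fu: "fourier H (z - y) = fourier ?u z" for z
    unfolding fourier_def
    by (intro Bochner_Integration.integral_cong)
       (auto simp: algebra_simps inner_diff_right inner_commute simp flip: exp_add)
  have "gaussian 1 (z /\<^sub>R t) = gaussian ?s z" for z :: 'a
  proof -
    have n: "norm (z /\<^sub>R t) = norm z / t" using t by (simp add: divide_inverse mult.commute)
    show ?thesis unfolding gaussian_def n by (simp add: power_divide)
  qed
  then have dil: "dilate t (\<lambda>x. of_real (c * gaussian 1 x)) z = of_real (c / t ^ DIM('a)) * of_real (gaussian ?s z)" for z :: 'a
    by (simp add: dilate_def)
  have [measurable]: "fourier H \<in> borel_measurable borel" by (rule borel_measurable_fourier[OF H])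
  have "distr_conv (distr_of_fun (\<lambda>x. of_real k * fourier H (- x))) (dilate t (\<lambda>x. of_real (c * gaussian 1 x))) y
    = (LINT x|lborel. of_real k * fourier H (- x) * (of_real (c / t ^ DIM('a)) * of_real (gaussian ?s (y - x))))"
    by (simp only: distr_conv_def distr_of_fun_def dil)
  also have "\<dots> = (LINT z|lborel. of_real (k * (c / t ^ DIM('a))) * (fourier ?u z * of_real (gaussian ?s z) * exp (\<i> * of_real (0 \<bullet> z))))"
    by (subst lborel_integral_affine[where c="-1" and t=y]) (auto simp: fu mult_ac)
  also have "\<dots> = of_real (k * (c / t ^ DIM('a))) * (LINT z|lborel. fourier ?u z * of_real (gaussian ?s z) * exp (\<i> * of_real (0 \<bullet> z)))"
    by (rule integral_mult_right_zero)
  also have "\<dots> = of_real (k * (c / t ^ DIM('a))) * (of_real (sqrt (2 * pi / ?s) ^ DIM('a)) *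
      (LINT \<xi>|lborel. ?u \<xi> * of_real (gaussian (1 / ?s) (\<xi> - 0))))"
    using t by (subst integral_fourier_gaussian[OF u]) auto
  also have "(LINT \<xi>|lborel. ?u \<xi> * of_real (gaussian (1 / ?s) (\<xi> - 0))) = fourier (\<lambda>\<xi>. H \<xi> * of_real (gaussian (t\<^sup>2) \<xi>)) (- y)"
    by (simp add: fourier_def inner_commute mult_ac)
  also have "complex_of_real (k * (c / t ^ DIM('a))) * (of_real (sqrt (2 * pi / ?s) ^ DIM('a)) * fourier (\<lambda>\<xi>. H \<xi> * of_real (gaussian (t\<^sup>2) \<xi>)) (- y))
      = of_real (k * c * sqrt (2 * pi) ^ DIM('a)) * fourier (\<lambda>\<xi>. H \<xi> * of_real (gaussian (t\<^sup>2) \<xi>)) (- y)"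
  proof -
    have "sqrt (2 * pi / ?s) = sqrt (2 * pi) * t" using t by (simp add: real_sqrt_mult)
    then have "k * (c / t ^ DIM('a)) * sqrt (2 * pi / ?s) ^ DIM('a) = k * c * sqrt (2 * pi) ^ DIM('a)"
      using t by (simp only: power_mult_distrib) (simp add: field_simps)
    then show ?thesis by (simp only: mult.assoc[symmetric] of_real_mult[symmetric])
  qed
  finally show ?thesis .
qed

lemma ennreal_power2_le_imp_le:
  fixes x y :: ennreal
  assumes "x\<^sup>2 \<le> y\<^sup>2"
  shows "x \<le> y"
proof (cases y)
  case (real b)
  then have "x\<^sup>2 < top" using assms by (auto simp: ennreal_power intro: le_less_trans)
  then have "x < top" by (cases x) (auto simp: power2_eq_square)
  then obtain a where a: "x = ennreal a" "0 \<le> a" by (cases x) auto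
  then have "a\<^sup>2 \<le> b\<^sup>2" using assms real by (simp add: ennreal_power)
  then show ?thesis using a real power2_le_imp_le[of a b] by (simp add: ennreal_leI)
qed simp

text \<open>
  Cauchy--Schwarz on \<open>S\<close>, whose measure is at most \<open>v t\<^sup>-\<^sup>d\<close>, followed by Plancherel: for \<open>|\<xi>| \<le> 1/t\<close>
  the square of the Gaussian is at least \<open>1/e\<close>, so inserting it costs a factor \<open>e\<close>.
\<close>

lemma nn_integral_low_frequency_le:
  fixes H :: "'a::euclidean_space \<Rightarrow> complex"
  assumes H: "integrable lborel H" and cont: "continuous_on UNIV H" and bd: "\<And>x. norm (H x) \<le> K"
    and t: "0 < t" and S: "S \<in> sets borel" "S \<subseteq> cball 0 (1 / t)"
  shows "(\<integral>\<^sup>+\<xi>. ennreal (norm (H \<xi>)) * indicator S \<xi> \<partial>lborel)\<^sup>2 \<le>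
    ennreal (exp 1 * unit_ball_vol (real DIM('a)) / (2 * pi) ^ DIM('a) * (1 / t) ^ DIM('a)) *
     (\<integral>\<^sup>+y. ennreal ((norm (fourier (\<lambda>\<xi>. H \<xi> * of_real (gaussian (t\<^sup>2) \<xi>)) y))\<^sup>2) \<partial>lborel)"
proof -
  let ?v = "unit_ball_vol (real DIM('a))"
  let ?h = "\<lambda>\<xi>. H \<xi> * of_real (gaussian (t\<^sup>2) \<xi>)"
  let ?F = "\<integral>\<^sup>+y. ennreal ((norm (fourier ?h y))\<^sup>2) \<partial>lborel"
  have [measurable]: "H \<in> borel_measurable borel" using borel_measurable_integrable[OF H] by simp
  note S(1)[measurable]
  have g1: "gaussian (t\<^sup>2) \<xi> \<le> 1" for \<xi> :: 'a by simp
  have h: "integrable lborel ?h"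
    by (rule Bochner_Integration.integrable_bound[OF H]) (auto simp: norm_mult mult_left_le)
  have hb: "norm (?h x) \<le> K" for x
    using mult_left_le[OF g1[of x], of "norm (H x)"] bd[of x] by (simp add: norm_mult)
  have hc: "continuous_on UNIV ?h" by (intro continuous_intros cont)
  have planch: "ennreal ((2 * pi) ^ DIM('a)) * (\<integral>\<^sup>+x. ennreal ((norm (?h x))\<^sup>2) \<partial>lborel) \<le> ?F"
    by (rule nn_integral_power2_le_fourier[OF h hc hb])
  have point: "(norm (H \<xi>))\<^sup>2 \<le> exp 1 * (norm (?h \<xi>))\<^sup>2" if "\<xi> \<in> S" for \<xi>
  proof -
    have "norm \<xi> \<le> 1 / t" using S(2) that by auto
    then have "t * norm \<xi> \<le> 1" using t by (simp add: field_simps)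
    then have "(t * norm \<xi>)\<^sup>2 \<le> 1" using t by (simp add: power_le_one)
    then have "1 \<le> exp 1 * exp (- (t * norm \<xi>)\<^sup>2)" by (simp flip: exp_add)
    also have "exp (- (t * norm \<xi>)\<^sup>2) = (gaussian (t\<^sup>2) \<xi>)\<^sup>2"
      by (simp add: gaussian_def power_mult_distrib flip: exp_double)
    finally have "(norm (H \<xi>))\<^sup>2 * 1 \<le> (norm (H \<xi>))\<^sup>2 * (exp 1 * (gaussian (t\<^sup>2) \<xi>)\<^sup>2)"
      by (intro mult_left_mono) auto
    then show ?thesis by (simp add: norm_mult power_mult_distrib mult_ac)
  qed
  have "(\<integral>\<^sup>+\<xi>. ennreal (norm (H \<xi>)) * indicator S \<xi> \<partial>lborel)\<^sup>2
      = (\<integral>\<^sup>+\<xi>. (ennreal (norm (H \<xi>)) * indicator S \<xi>) * indicator S \<xi> \<partial>lborel)\<^sup>2"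
    by (intro arg_cong[where f="\<lambda>x. x\<^sup>2"] nn_integral_cong) (simp add: indicator_def)
  also have "\<dots> \<le> (\<integral>\<^sup>+\<xi>. (ennreal (norm (H \<xi>)) * indicator S \<xi>)\<^sup>2 \<partial>lborel) * (\<integral>\<^sup>+\<xi>. (indicator S \<xi>)\<^sup>2 \<partial>lborel)"
    by (rule Cauchy_Schwarz_nn_integral) measurable
  also have "\<dots> \<le> (ennreal (exp 1 / (2 * pi) ^ DIM('a)) * ?F) * ennreal (?v * (1 / t) ^ DIM('a))"
  proof (rule mult_mono)
    have "(\<integral>\<^sup>+\<xi>. (ennreal (norm (H \<xi>)) * indicator S \<xi>)\<^sup>2 \<partial>lborel)
      \<le> (\<integral>\<^sup>+\<xi>. ennreal (exp 1) * ennreal ((norm (?h \<xi>))\<^sup>2) \<partial>lborel)"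
      using point by (intro nn_integral_mono) (auto simp: indicator_def ennreal_power simp flip: ennreal_mult' intro!: ennreal_leI)
    also have "\<dots> = ennreal (exp 1) * (\<integral>\<^sup>+\<xi>. ennreal ((norm (?h \<xi>))\<^sup>2) \<partial>lborel)"
      by (rule nn_integral_cmult) measurable
    also have "\<dots> = ennreal (exp 1 / (2 * pi) ^ DIM('a)) * (ennreal ((2 * pi) ^ DIM('a)) * (\<integral>\<^sup>+x. ennreal ((norm (?h x))\<^sup>2) \<partial>lborel))"
      by (subst mult.assoc[symmetric], subst ennreal_mult'[symmetric]) auto
    also have "\<dots> \<le> ennreal (exp 1 / (2 * pi) ^ DIM('a)) * ?F" by (intro mult_left_mono planch) simp
    finally show "(\<integral>\<^sup>+\<xi>. (ennreal (norm (H \<xi>)) * indicator S \<xi>)\<^sup>2 \<partial>lborel) \<le> ennreal (exp 1 / (2 * pi) ^ DIM('a)) * ?F" .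
    have "(\<integral>\<^sup>+\<xi>. (indicator S \<xi>)\<^sup>2 \<partial>lborel) = (\<integral>\<^sup>+\<xi>. indicator S \<xi> \<partial>lborel)"
      by (intro nn_integral_cong) (simp add: indicator_def)
    also have "\<dots> \<le> emeasure lborel (cball 0 (1 / t) :: 'a set)" using S by (simp add: emeasure_mono)
    also have "\<dots> = ennreal (?v * (1 / t) ^ DIM('a))" using t by (simp add: emeasure_cball)
    finally show "(\<integral>\<^sup>+\<xi>. (indicator S \<xi>)\<^sup>2 \<partial>lborel) \<le> ennreal (?v * (1 / t) ^ DIM('a))" .
  qed auto
  also have "\<dots> = ennreal (exp 1 / (2 * pi) ^ DIM('a)) * ennreal (?v * (1 / t) ^ DIM('a)) * ?F" by (simp only: mult_ac)
  also have "\<dots> = ennreal (exp 1 * ?v / (2 * pi) ^ DIM('a) * (1 / t) ^ DIM('a)) * ?F"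
    by (subst ennreal_mult'[symmetric]) (simp_all add: field_simps)
  finally show ?thesis .
qed

text \<open>
  Without this the integral defining the multiplier operator would be the default value \<open>0\<close>, and the
  operator would carry no information about \<open>f\<close>.
\<close>

lemma multiplier_symbol_integrable:
  fixes \<sigma> :: "'a::euclidean_space \<Rightarrow> real" and f :: "'a \<Rightarrow> complex"
  assumes f: "f \<in> schwartz" and \<sigma>: "continuous_on UNIV \<sigma>" "\<And>\<xi>. \<bar>\<sigma> \<xi>\<bar> \<le> c * (1 + norm \<xi>) ^ N"
  shows "continuous_on UNIV (\<lambda>\<xi>. of_real (\<sigma> \<xi>) * fourier f \<xi>)"
    and "integrable lborel (\<lambda>\<xi>. of_real (\<sigma> \<xi>) * fourier f \<xi>)"
    and "\<exists>K. \<forall>\<xi>. norm (of_real (\<sigma> \<xi>) * fourier f \<xi>) \<le> K"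
proof -
  show cont: "continuous_on UNIV (\<lambda>\<xi>. of_real (\<sigma> \<xi>) * fourier f \<xi>)"
    by (intro continuous_intros \<sigma> continuous_on_fourier integrable_schwartz f)
  obtain C where C: "C \<ge> 0" "\<And>\<xi>. norm (fourier f \<xi>) \<le> C / (1 + norm \<xi>) ^ (N + 2 * DIM('a))"
    using fourier_schwartz_bound[OF f] by blast
  have c: "0 \<le> c" using order_trans[OF abs_ge_zero \<sigma>(2)[of 0]] by simp
  have pos: "0 < (1 + norm \<xi>) ^ k" for \<xi> :: 'a and k by (intro zero_less_power add_pos_nonneg) auto
  have bd: "norm (of_real (\<sigma> \<xi>) * fourier f \<xi>) \<le> (c * C) / (1 + norm \<xi>) ^ (2 * DIM('a))" for \<xi>
  proof -
    have "norm (of_real (\<sigma> \<xi>) * fourier f \<xi>) \<le> (c * (1 + norm \<xi>) ^ N) * (C / (1 + norm \<xi>) ^ (N + 2 * DIM('a)))"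
      unfolding norm_mult norm_of_real using c by (intro mult_mono \<sigma>(2) C(2)) auto
    also have "\<dots> = (c * C) / (1 + norm \<xi>) ^ (2 * DIM('a))"
      using pos[of \<xi> N] by (simp add: power_add)
    finally show ?thesis .
  qed
  show "integrable lborel (\<lambda>\<xi>. of_real (\<sigma> \<xi>) * fourier f \<xi>)"
    by (rule integrable_rapid_decay[OF cont bd])
  have "norm (of_real (\<sigma> \<xi>) * fourier f \<xi>) \<le> c * C" for \<xi>
  proof (rule order_trans[OF bd])
    have "1 \<le> (1 + norm \<xi>) ^ (2 * DIM('a))" by (intro one_le_power) simp
    then show "c * C / (1 + norm \<xi>) ^ (2 * DIM('a)) \<le> c * C"
      using divide_left_mono[of 1 _ "c * C"] c C(1) pos[of \<xi>] by simp
  qed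
  then show "\<exists>K. \<forall>\<xi>. norm (of_real (\<sigma> \<xi>) * fourier f \<xi>) \<le> K" by blast
qed

text \<open>
  The Hardy inequality for a family of pieces \<open>S j\<close> that covers almost all frequencies. A piece may be
  empty; a nonempty one needs the maximal function at the scale \<open>2\<^sup>-\<^sup>j\<close>, so the choice of pieces decides
  whether the full or the local maximal function suffices.
\<close>

lemma multiplier_sup_bound:
  fixes \<sigma> :: "'a::euclidean_space \<Rightarrow> real" and S :: "int \<Rightarrow> 'a set"
  defines "v \<equiv> unit_ball_vol (real DIM('a))"
  assumes \<Psi>: "growth_function p \<Psi>"
    and \<sigma>: "continuous_on UNIV \<sigma>" "\<And>\<xi>. \<bar>\<sigma> \<xi>\<bar> \<le> c * (1 + norm \<xi>) ^ N"
    and S: "\<And>j. S j \<in> sets borel" "\<And>j. S j \<subseteq> cball 0 (2 powr real_of_int j)"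
      "AE \<xi> in lborel. \<exists>j. \<xi> \<in> S j"
    and low: "\<And>j \<xi>. \<xi> \<in> S j \<Longrightarrow> growth_inv \<Psi> ((2 powr real_of_int j) ^ DIM('a) / v) \<le> \<sigma> \<xi>"
    and scales: "\<And>j. S j \<noteq> {} \<Longrightarrow> 2 powr (- real_of_int j) \<in> scales"
  shows "\<exists>B>0. \<forall>f\<in>schwartz. \<forall>l>0.
    modular \<Psi> (\<lambda>x. ennreal (inverse l) * maximal_fun scales m (distr_of_fun (fourier_multiplier \<sigma> f)) x) \<le> 1 \<longrightarrow>
    (\<forall>x. norm (f x) \<le> B * l)"
proof -
  define d where "d = DIM('a)"
  have v: "0 < v" by (simp add: v_def)
  obtain c0 where c0: "c0 > 0" "(\<lambda>x::'a. complex_of_real (c0 * gaussian 1 x)) \<in> test_class m"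
    using gaussian_in_test_class by blast
  obtain C where C: "C > 0" "\<And>W::'a \<Rightarrow> ennreal. W \<in> borel_measurable borel \<Longrightarrow> modular \<Psi> W \<le> 1 \<Longrightarrow>
    (\<integral>\<^sup>+j. ennreal (2 powr (real_of_int j * real d / 2) / growth_inv \<Psi> ((2 powr real_of_int j) ^ d / v)) *
      (\<integral>\<^sup>+n. ennreal (2 * 2 powr real_of_int n * sqrt (level_measure W n)) *
        indicator {n. v * (2 powr (- real_of_int j)) ^ d \<le> level_measure W n} n \<partial>count_space UNIV)
      \<partial>count_space UNIV) \<le> ennreal C"
    using hardy_sum_le[where 'a='a, OF \<Psi>] unfolding v_def d_def by blast
  define k where "k = 1 / (2 * pi) ^ d"
  \<comment> \<open>The factor that \<open>distr_conv_gaussian\<close> produces for the test function \<open>c0 * gaussian 1\<close>.\<close>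
  define \<kappa> where "\<kappa> = k * c0 * sqrt (2 * pi) ^ d"
  have \<kappa>: "0 < \<kappa>" using c0 by (simp add: \<kappa>_def k_def)
  \<comment> \<open>Square root of the constant in \<open>nn_integral_low_frequency_le\<close>, divided by \<open>\<kappa>\<close> since \<open>G\<close> carries that factor.\<close>
  define D where "D = sqrt (exp 1 * v / (2 * pi) ^ d) / \<kappa>"
  have D: "0 < D" using v \<kappa> by (simp add: D_def)
  show ?thesis
  proof (intro exI[of _ "D * C / (2 * pi) ^ d"] conjI ballI allI impI)
    show "0 < D * C / (2 * pi) ^ d" using C D by simp
    fix f :: "'a \<Rightarrow> complex" and l :: real and x0 :: 'a
    assume f: "f \<in> schwartz" and l: "0 < l"
    define H where "H = (\<lambda>\<xi>. of_real (\<sigma> \<xi>) * fourier f \<xi>)"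
    define W where "W = (\<lambda>x. ennreal (inverse l) * maximal_fun scales m (distr_of_fun (fourier_multiplier \<sigma> f)) x)"
    assume "modular \<Psi> (\<lambda>x. ennreal (inverse l) * maximal_fun scales m (distr_of_fun (fourier_multiplier \<sigma> f)) x) \<le> 1"
    then have mod: "modular \<Psi> W \<le> 1" by (simp add: W_def)
    note [measurable] = borel_measurable_maximal_fun
    have W[measurable]: "W \<in> borel_measurable borel" unfolding W_def by measurable
    have H: "integrable lborel H" "continuous_on UNIV H"
      using multiplier_symbol_integrable[OF f \<sigma>] by (simp_all add: H_def)
    obtain K where K: "\<And>\<xi>. norm (H \<xi>) \<le> K"
      using multiplier_symbol_integrable(3)[OF f \<sigma>] by (auto simp: H_def)
    have [measurable]: "H \<in> borel_measurable borel" using borel_measurable_integrable[OF H(1)] by simp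
    note S(1)[measurable]
    have [measurable]: "fourier f \<in> borel_measurable borel"
      by (intro borel_measurable_fourier integrable_schwartz f)
    have mult: "fourier_multiplier \<sigma> f = (\<lambda>x. of_real k * fourier H (- x))"
      by (simp add: fun_eq_iff fourier_multiplier_def fourier_def H_def k_def d_def inner_commute)
    let ?A = "\<lambda>j. \<integral>\<^sup>+n. ennreal (2 * 2 powr real_of_int n * sqrt (level_measure W n)) *
        indicator {n. v * (2 powr (- real_of_int j)) ^ d \<le> level_measure W n} n \<partial>count_space UNIV"
    have shell: "(\<integral>\<^sup>+\<xi>. ennreal (norm (H \<xi>)) * indicator (S j) \<xi> \<partial>lborel) \<le>
        ennreal (D * l * 2 powr (real_of_int j * real d / 2)) * ?A j" for j
    proof (cases "S j = {}")
      case False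
      define t where "t = 2 powr (- real_of_int j)"
      have t: "0 < t" "t \<in> scales" "1 / t = 2 powr real_of_int j"
        using scales[OF False] by (auto simp: t_def powr_minus field_simps)
      let ?h = "\<lambda>\<xi>. H \<xi> * of_real (gaussian (t\<^sup>2) \<xi>)"
      define G where "G = (\<lambda>y. \<kappa> / l * norm (fourier ?h (- y)))"
      have h: "integrable lborel ?h"
        by (rule Bochner_Integration.integrable_bound[OF H(1)]) (auto simp: norm_mult mult_left_le)
      have [measurable]: "fourier ?h \<in> borel_measurable borel" by (rule borel_measurable_fourier[OF h])
      have G: "ennreal (G y) \<le> W x" if "dist x y < t" for x y
      proof -
        have "\<kappa> * norm (fourier ?h (- y)) = norm (distr_conv (distr_of_fun (fourier_multiplier \<sigma> f))
            (dilate t (\<lambda>x. of_real (c0 * gaussian 1 x))) y)"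
          unfolding mult distr_conv_gaussian[OF H(1) t(1)] norm_mult norm_of_real
          using \<kappa> by (simp add: \<kappa>_def d_def)
        also have "ennreal \<dots> \<le> maximal_fun scales m (distr_of_fun (fourier_multiplier \<sigma> f)) x"
          unfolding maximal_fun_def
          by (rule SUP_upper2[OF c0(2)], rule SUP_upper2[OF t(2)], rule SUP_upper2[of y]) (use that in auto)
        finally have "ennreal (inverse l) * ennreal (\<kappa> * norm (fourier ?h (- y))) \<le> W x"
          unfolding W_def by (intro mult_left_mono) auto
        then show ?thesis using l by (simp add: G_def ennreal_mult'[symmetric] field_simps)
      qed
      have fin: "emeasure lborel {x. ennreal (2 powr real_of_int n) < W x} < \<infinity>" for n
        by (rule level_measure_chebyshev(1)[OF \<Psi> W mod])
      have "(\<integral>\<^sup>+x. ennreal ((G x)\<^sup>2) \<partial>lborel) \<le> (?A j)\<^sup>2"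
        unfolding v_def d_def t_def[symmetric]
        by (rule nn_integral_power2_le_level_sum[OF W fin _ G t(1)]) (use \<kappa> l in \<open>auto simp: G_def\<close>)
      moreover have "(\<integral>\<^sup>+x. ennreal ((G x)\<^sup>2) \<partial>lborel) = ennreal ((\<kappa> / l)\<^sup>2) * (\<integral>\<^sup>+y. ennreal ((norm (fourier ?h y))\<^sup>2) \<partial>lborel)"
      proof -
        have "(\<integral>\<^sup>+x. ennreal ((G x)\<^sup>2) \<partial>lborel) = (\<integral>\<^sup>+x. ennreal ((\<kappa> / l)\<^sup>2) * ennreal ((norm (fourier ?h (- x)))\<^sup>2) \<partial>lborel)"
          unfolding G_def power_mult_distrib by (intro nn_integral_cong ennreal_mult') simp
        also have "\<dots> = ennreal ((\<kappa> / l)\<^sup>2) * (\<integral>\<^sup>+x. ennreal ((norm (fourier ?h (- x)))\<^sup>2) \<partial>lborel)"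
          by (rule nn_integral_cmult) measurable
        also have "(\<integral>\<^sup>+x. ennreal ((norm (fourier ?h (- x)))\<^sup>2) \<partial>lborel) = (\<integral>\<^sup>+y. ennreal ((norm (fourier ?h y))\<^sup>2) \<partial>lborel)"
          by (rule nn_integral_lborel_uminus) measurable
        finally show ?thesis .
      qed
      ultimately have le: "ennreal ((\<kappa> / l)\<^sup>2) * (\<integral>\<^sup>+y. ennreal ((norm (fourier ?h y))\<^sup>2) \<partial>lborel) \<le> (?A j)\<^sup>2" by simp
      let ?q = "exp 1 * v / (2 * pi) ^ d * (1 / t) ^ d"
      have q: "?q = (D * l * 2 powr (real_of_int j * real d / 2))\<^sup>2 * (\<kappa> / l)\<^sup>2"
      proof -
        have "(2 powr (real_of_int j * real d / 2))\<^sup>2 = (2 powr real_of_int j) ^ d"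
          by (simp add: powr_powr flip: powr_realpow powr_numeral)
        moreover have "D\<^sup>2 * \<kappa>\<^sup>2 = exp 1 * v / (2 * pi) ^ d"
          using \<kappa> v by (simp add: D_def power_divide)
        ultimately have "?q = (D\<^sup>2 * \<kappa>\<^sup>2) * (2 powr (real_of_int j * real d / 2))\<^sup>2"
          unfolding t(3) by (simp only:)
        then show ?thesis using l by (simp add: power_mult_distrib power_divide)
      qed
      have "(\<integral>\<^sup>+\<xi>. ennreal (norm (H \<xi>)) * indicator (S j) \<xi> \<partial>lborel)\<^sup>2 \<le>
          ennreal ?q * (\<integral>\<^sup>+y. ennreal ((norm (fourier ?h y))\<^sup>2) \<partial>lborel)"
        unfolding v_def d_def
        by (rule nn_integral_low_frequency_le[OF H K t(1) S(1)]) (use S(2)[of j] t(3) in simp)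
      also have "\<dots> = ennreal ((D * l * 2 powr (real_of_int j * real d / 2))\<^sup>2) *
          (ennreal ((\<kappa> / l)\<^sup>2) * (\<integral>\<^sup>+y. ennreal ((norm (fourier ?h y))\<^sup>2) \<partial>lborel))"
        unfolding q by (simp only: ennreal_mult' zero_le_power2 mult.assoc)
      also have "\<dots> \<le> ennreal ((D * l * 2 powr (real_of_int j * real d / 2))\<^sup>2) * (?A j)\<^sup>2"
        by (intro mult_left_mono le) simp
      also have "\<dots> = (ennreal (D * l * 2 powr (real_of_int j * real d / 2)) * ?A j)\<^sup>2"
        using D l by (subst ennreal_power[symmetric]) (simp_all add: power_mult_distrib)
      finally show ?thesis by (rule ennreal_power2_le_imp_le)
    qed simp
    have piece: "(\<integral>\<^sup>+\<xi>. ennreal (norm (fourier f \<xi>)) * indicator (S j) \<xi> \<partial>lborel) \<le>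
        ennreal (D * l) * (ennreal (2 powr (real_of_int j * real d / 2) / growth_inv \<Psi> ((2 powr real_of_int j) ^ d / v)) * ?A j)" for j
    proof -
      define r where "r = growth_inv \<Psi> ((2 powr real_of_int j) ^ d / v)"
      have r: "0 < r" unfolding r_def using v by (intro growth_inv_pos[OF \<Psi>]) simp
      have pt: "norm (fourier f \<xi>) \<le> 1 / r * norm (H \<xi>)" if "\<xi> \<in> S j" for \<xi>
      proof -
        have "r \<le> \<sigma> \<xi>" using low[OF that] by (simp add: r_def d_def)
        then have "r * norm (fourier f \<xi>) \<le> \<sigma> \<xi> * norm (fourier f \<xi>)" by (intro mult_right_mono) auto
        also have "\<dots> = norm (H \<xi>)" using r \<open>r \<le> \<sigma> \<xi>\<close> by (simp add: H_def norm_mult)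
        finally show ?thesis using r by (simp add: field_simps)
      qed
      have "(\<integral>\<^sup>+\<xi>. ennreal (norm (fourier f \<xi>)) * indicator (S j) \<xi> \<partial>lborel)
        \<le> (\<integral>\<^sup>+\<xi>. ennreal (1 / r) * (ennreal (norm (H \<xi>)) * indicator (S j) \<xi>) \<partial>lborel)"
      proof (rule nn_integral_mono)
        fix \<xi>
        have "ennreal (norm (fourier f \<xi>)) \<le> ennreal (1 / r) * ennreal (norm (H \<xi>))" if "\<xi> \<in> S j"
          using ennreal_leI[OF pt[OF that]] r by (subst ennreal_mult'[symmetric]) auto
        then show "ennreal (norm (fourier f \<xi>)) * indicator (S j) \<xi> \<le> ennreal (1 / r) * (ennreal (norm (H \<xi>)) * indicator (S j) \<xi>)"
          by (simp add: indicator_def)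
      qed
      also have "\<dots> = ennreal (1 / r) * (\<integral>\<^sup>+\<xi>. ennreal (norm (H \<xi>)) * indicator (S j) \<xi> \<partial>lborel)"
        by (rule nn_integral_cmult) measurable
      also have "\<dots> \<le> ennreal (1 / r) * (ennreal (D * l * 2 powr (real_of_int j * real d / 2)) * ?A j)"
        by (intro mult_left_mono shell) simp
      also have "\<dots> = ennreal (1 / r * (D * l * 2 powr (real_of_int j * real d / 2))) * ?A j"
        using r by (subst mult.assoc[symmetric], subst ennreal_mult') simp_all
      also have "1 / r * (D * l * 2 powr (real_of_int j * real d / 2)) = (D * l) * (2 powr (real_of_int j * real d / 2) / r)"
        by simp
      also have "ennreal \<dots> * ?A j = ennreal (D * l) * (ennreal (2 powr (real_of_int j * real d / 2) / r) * ?A j)"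
        using D l by (subst mult.assoc[symmetric], subst ennreal_mult') simp_all
      finally show ?thesis unfolding r_def .
    qed
    have "(\<integral>\<^sup>+\<xi>. ennreal (norm (fourier f \<xi>)) \<partial>lborel)
      \<le> (\<integral>\<^sup>+\<xi>. \<integral>\<^sup>+j. ennreal (norm (fourier f \<xi>)) * indicator (S j) \<xi> \<partial>count_space UNIV \<partial>lborel)"
    proof (rule nn_integral_mono_AE, use S(3) in eventually_elim)
      case (elim \<xi>)
      then obtain j where "\<xi> \<in> S j" by blast
      then have "ennreal (norm (fourier f \<xi>)) = ennreal (norm (fourier f \<xi>)) * indicator (S j) \<xi>" by simp
      also have "\<dots> \<le> (\<integral>\<^sup>+j. ennreal (norm (fourier f \<xi>)) * indicator (S j) \<xi> \<partial>count_space UNIV)"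
        by (rule nn_integral_ge_point[where p="\<lambda>j. ennreal (norm (fourier f \<xi>)) * indicator (S j) \<xi>"]) simp
      finally show ?case .
    qed
    also have "\<dots> = (\<integral>\<^sup>+j. \<integral>\<^sup>+\<xi>. ennreal (norm (fourier f \<xi>)) * indicator (S j) \<xi> \<partial>lborel \<partial>count_space UNIV)"
      by (rule nn_integral_count_space_nn_integral) auto
    also have "\<dots> \<le> (\<integral>\<^sup>+j. ennreal (D * l) * (ennreal (2 powr (real_of_int j * real d / 2) / growth_inv \<Psi> ((2 powr real_of_int j) ^ d / v)) * ?A j) \<partial>count_space UNIV)"
      by (intro nn_integral_mono piece)
    also have "\<dots> = ennreal (D * l) * (\<integral>\<^sup>+j. ennreal (2 powr (real_of_int j * real d / 2) / growth_inv \<Psi> ((2 powr real_of_int j) ^ d / v)) * ?A j \<partial>count_space UNIV)"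
      by (rule nn_integral_cmult) simp
    also have "\<dots> \<le> ennreal (D * l) * ennreal C" by (intro mult_left_mono C(2) W mod) simp
    also have "\<dots> = ennreal (D * l * C)" using C(1) by (intro ennreal_mult''[symmetric]) simp
    finally have up: "(\<integral>\<^sup>+\<xi>. ennreal (norm (fourier f \<xi>)) \<partial>lborel) \<le> ennreal (D * l * C)" .
    obtain Kf where Kf: "\<And>x. norm (f x) \<le> Kf"
      using schwartz_bound[OF f, of 0] by auto
    have "ennreal ((2 * pi) ^ d * norm (f x0)) \<le> ennreal (D * l * C)"
      using norm_le_nn_integral_fourier[OF integrable_schwartz[OF f] continuous_on_schwartz[OF f] Kf, of x0] up
      unfolding d_def by (rule order_trans)
    then have "(2 * pi) ^ d * norm (f x0) \<le> D * l * C"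
      by (rule ennreal_le_iff[THEN iffD1, rotated]) (use D l C(1) in simp)
    then show "norm (f x0) \<le> D * C / (2 * pi) ^ d * l"
      by (simp add: field_simps)
  qed
qed

lemma Linf_norm_le_luxemburg:
  assumes f: "f \<in> schwartz" and B: "0 < B"
    and bd: "\<And>l. 0 < l \<Longrightarrow> modular \<Psi> (\<lambda>x. ennreal (inverse l) * F x) \<le> 1 \<Longrightarrow> \<forall>x. norm (f x) \<le> B * l"
  shows "Linf_norm f \<le> ennreal B * luxemburg \<Psi> F"
proof -
  have [measurable]: "f \<in> borel_measurable borel"
    by (intro borel_measurable_continuous_onI continuous_on_schwartz f)
  have "Linf_norm f / ennreal B \<le> luxemburg \<Psi> F"
    unfolding luxemburg_def
  proof (rule INF_greatest)
    fix l assume "l \<in> {l. 0 < l \<and> modular \<Psi> (\<lambda>x. ennreal (inverse l) * F x) \<le> 1}"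
    then have "\<forall>x. norm (f x) \<le> B * l" and l: "0 < l" using bd by auto
    then have "Linf_norm f \<le> ennreal (B * l)"
      unfolding Linf_norm_def by (intro esssup_I always_eventually allI ennreal_leI) auto
    then have "Linf_norm f / ennreal B \<le> ennreal (B * l) / ennreal B" by (rule divide_right_mono_ennreal)
    also have "\<dots> = ennreal l" using B l by (simp add: divide_ennreal)
    finally show "Linf_norm f / ennreal B \<le> ennreal l" .
  qed
  then have "ennreal B * (Linf_norm f / ennreal B) \<le> ennreal B * luxemburg \<Psi> F" by (rule mult_left_mono) simp
  moreover have "ennreal B * (Linf_norm f / ennreal B) = Linf_norm f"
    using B by (simp add: ennreal_times_divide ennreal_mult_divide_eq mult.commute)
  ultimately show ?thesis by simp
qed

text \<open>
  Both symbols have this form, with \<open>\<tau>\<close> equal to \<open>|\<xi>|\<^sup>d\<close> and \<open>(1 + |\<xi>|\<^sup>2)\<^sup>d\<^sup>/\<^sup>2\<close>.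
\<close>

lemma growth_inv_symbol_bound:
  assumes \<Psi>: "growth_function p \<Psi>" and a: "0 < a"
    and \<tau>: "\<And>\<xi>::'a::euclidean_space. 0 \<le> \<tau> \<xi>" "\<And>\<xi>. \<tau> \<xi> \<le> (1 + norm \<xi>) ^ d"
  shows "\<exists>c N. \<forall>\<xi>. \<bar>growth_inv \<Psi> (a * \<tau> \<xi>)\<bar> \<le> c * (1 + norm \<xi>) ^ N"
proof -
  obtain b N where b: "b \<ge> 0" "\<And>r. r \<ge> 0 \<Longrightarrow> growth_inv \<Psi> r \<le> (1 + b * r) ^ N"
    using growth_inv_polynomial_bound[OF \<Psi>] by blast
  have "\<bar>growth_inv \<Psi> (a * \<tau> \<xi>)\<bar> \<le> (1 + b * a) ^ N * (1 + norm \<xi>) ^ (d * N)" for \<xi>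
  proof -
    have r: "0 \<le> a * \<tau> \<xi>" using a \<tau>(1) by simp
    have "1 + b * (a * \<tau> \<xi>) \<le> (1 + norm \<xi>) ^ d + b * a * (1 + norm \<xi>) ^ d"
      using a b(1) \<tau>(2)[of \<xi>] by (intro add_mono) (auto simp: mult.assoc intro!: mult_left_mono)
    then have "(1 + b * (a * \<tau> \<xi>)) ^ N \<le> ((1 + b * a) * (1 + norm \<xi>) ^ d) ^ N"
      using a b(1) \<tau>(1)[of \<xi>] by (intro power_mono) (auto simp: algebra_simps)
    moreover have "\<bar>growth_inv \<Psi> (a * \<tau> \<xi>)\<bar> = growth_inv \<Psi> (a * \<tau> \<xi>)"
      using growth_inv_nonneg[OF \<Psi> r] by simp
    ultimately show ?thesis using b(2)[OF r] by (simp add: power_mult_distrib power_mult)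
  qed
  then show ?thesis by blast
qed

lemma dyadic_shellE:
  assumes "0 < (r::real)"
  obtains j :: int where "2 powr (real_of_int j - 1) < r" "r \<le> 2 powr real_of_int j"
proof -
  have "real_of_int \<lceil>log 2 r\<rceil> - 1 < log 2 r" by linarith
  then have "2 powr (real_of_int \<lceil>log 2 r\<rceil> - 1) < r" using assms by (simp add: less_log_iff)
  moreover have "r \<le> 2 powr real_of_int \<lceil>log 2 r\<rceil>"
    using assms by (subst log_le_iff[symmetric]) auto
  ultimately show ?thesis by (rule that)
qed

text \<open>
  Dyadic shells at all scales. On the shell \<open>j\<close> one has \<open>a |\<xi>|\<^sup>d \<ge> (2\<^sup>d / v) 2\<^sup>(\<^sup>j\<^sup>-\<^sup>1\<^sup>)\<^sup>d = 2\<^sup>j\<^sup>d / v\<close>, and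
  \<open>\<Psi>\<^sup>-\<^sup>1\<close> is monotone.
\<close>

lemma riesz_sup_bound:
  assumes \<Psi>: "growth_function p \<Psi>"
  defines "a \<equiv> 2 ^ DIM('a::euclidean_space) / unit_ball_vol (real DIM('a))"
  shows "\<exists>B>0. \<forall>f::'a \<Rightarrow> complex. f \<in> schwartz \<longrightarrow>
    Linf_norm f \<le> ennreal B * hardy_orlicz_norm \<Psi> (distr_of_fun (riesz_operator \<Psi> a f))"
proof -
  let ?\<sigma> = "\<lambda>\<xi>::'a. growth_inv \<Psi> (a * norm \<xi> ^ DIM('a))"
  let ?S = "\<lambda>j::int. {\<xi>::'a. 2 powr (real_of_int j - 1) < norm \<xi> \<and> norm \<xi> \<le> 2 powr real_of_int j}"
  have a: "0 < a" by (simp add: a_def)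
  have "norm \<xi> ^ DIM('a) \<le> (1 + norm \<xi>) ^ DIM('a)" for \<xi> :: 'a by (intro power_mono) auto
  then obtain c N where cN: "\<And>\<xi>. \<bar>?\<sigma> \<xi>\<bar> \<le> c * (1 + norm \<xi>) ^ N"
    using growth_inv_symbol_bound[OF \<Psi> a, of "\<lambda>\<xi>::'a. norm \<xi> ^ DIM('a)" "DIM('a)"] by auto
  have "\<exists>B>0. \<forall>f\<in>schwartz. \<forall>l>0.
    modular \<Psi> (\<lambda>x. ennreal (inverse l) * maximal_fun {0<..} (moment_order DIM('a) \<Psi>) (distr_of_fun (fourier_multiplier ?\<sigma> f)) x) \<le> 1 \<longrightarrow>
    (\<forall>x. norm (f x) \<le> B * l)"
  proof (rule multiplier_sup_bound[OF \<Psi> _ cN, where S="?S"])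
    show "continuous_on UNIV ?\<sigma>"
      by (rule continuous_on_compose2[OF continuous_on_growth_inv[OF \<Psi>]])
         (use a in \<open>auto intro!: continuous_intros\<close>)
    show "?S j \<in> sets borel" for j by measurable
    show "AE \<xi> in lborel. \<exists>j. \<xi> \<in> ?S j"
      using AE_lborel_singleton[of "0::'a"]
    proof eventually_elim
      case (elim \<xi>)
      then show ?case using dyadic_shellE[of "norm \<xi>"] by (metis (mono_tags, lifting) mem_Collect_eq zero_less_norm_iff)
    qed
    show "growth_inv \<Psi> ((2 powr real_of_int j) ^ DIM('a) / unit_ball_vol (real DIM('a))) \<le> ?\<sigma> \<xi>" if "\<xi> \<in> ?S j" for j \<xi>
    proof (rule growth_inv_mono[OF \<Psi>])
      have "(2 powr real_of_int j) ^ DIM('a) = 2 ^ DIM('a) * (2 powr (real_of_int j - 1)) ^ DIM('a)"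
        by (simp add: powr_diff power_divide)
      also have "\<dots> \<le> 2 ^ DIM('a) * norm \<xi> ^ DIM('a)"
        using that by (intro mult_left_mono power_mono) auto
      finally show "(2 powr real_of_int j) ^ DIM('a) / unit_ball_vol (real DIM('a)) \<le> a * norm \<xi> ^ DIM('a)"
        by (simp add: a_def divide_right_mono)
    qed simp
  qed (auto simp: subset_iff)
  then obtain B where B: "B > 0" "\<And>f l. f \<in> schwartz \<Longrightarrow> l > 0 \<Longrightarrow>
    modular \<Psi> (\<lambda>x. ennreal (inverse l) * grand_maximal \<Psi> (distr_of_fun (riesz_operator \<Psi> a f)) x) \<le> 1 \<Longrightarrow>
    \<forall>x::'a. norm (f x) \<le> B * l"
    unfolding grand_maximal_def riesz_operator_def by blast
  have "Linf_norm f \<le> ennreal B * hardy_orlicz_norm \<Psi> (distr_of_fun (riesz_operator \<Psi> a f))" if "f \<in> schwartz" for f :: "'a \<Rightarrow> complex"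
    using Linf_norm_le_luxemburg[OF that B(1) B(2)[OF that]] B(1)
    by (auto simp: hardy_orlicz_norm_def ennreal_mult_top)
  then show ?thesis using B(1) by blast
qed

text \<open>
  The ball \<open>|\<xi>| \<le> 2\<close> replaces all shells with \<open>j \<le> 1\<close>. There \<open>1 + |\<xi>|\<^sup>2 \<ge> 1\<close> alone gives the lower bound
  \<open>a = 2\<^sup>d / v\<close> for the argument of \<open>\<Psi>\<^sup>-\<^sup>1\<close> that is needed for \<open>j = 1\<close>, and every scale \<open>2\<^sup>-\<^sup>j\<close> in use is below \<open>1\<close>.
\<close>

lemma bessel_sup_bound:
  assumes \<Psi>: "growth_function p \<Psi>"
  defines "a \<equiv> 2 ^ DIM('a::euclidean_space) / unit_ball_vol (real DIM('a))"
  shows "\<exists>B>0. \<forall>f::'a \<Rightarrow> complex. f \<in> schwartz \<longrightarrow>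
    Linf_norm f \<le> ennreal B * local_hardy_orlicz_norm \<Psi> (distr_of_fun (bessel_operator \<Psi> a f))"
proof -
  let ?\<tau> = "\<lambda>\<xi>::'a. (1 + (norm \<xi>)\<^sup>2) powr (real DIM('a) / 2)"
  let ?\<sigma> = "\<lambda>\<xi>. growth_inv \<Psi> (a * ?\<tau> \<xi>)"
  let ?S = "\<lambda>j::int. if j < 1 then {} else if j = 1 then cball 0 2
    else {\<xi>::'a. 2 powr (real_of_int j - 1) < norm \<xi> \<and> norm \<xi> \<le> 2 powr real_of_int j}"
  have a: "0 < a" by (simp add: a_def)
  have \<tau>: "?\<tau> \<xi> = sqrt (1 + (norm \<xi>)\<^sup>2) ^ DIM('a)" for \<xi> :: 'a
  proof -
    have pos: "0 < 1 + (norm \<xi>)\<^sup>2" by (intro add_pos_nonneg) auto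
    then have "?\<tau> \<xi> = ((1 + (norm \<xi>)\<^sup>2) powr (1 / 2)) powr real DIM('a)"
      by (simp only: powr_powr) simp
    also have "\<dots> = sqrt (1 + (norm \<xi>)\<^sup>2) ^ DIM('a)"
      using pos by (subst powr_half_sqrt) (auto simp: powr_realpow)
    finally show ?thesis .
  qed
  have "?\<tau> \<xi> \<le> (1 + norm \<xi>) ^ DIM('a)" for \<xi> :: 'a
    unfolding \<tau> by (intro power_mono real_le_lsqrt) (auto simp: power2_sum)
  then obtain c N where cN: "\<And>\<xi>. \<bar>?\<sigma> \<xi>\<bar> \<le> c * (1 + norm \<xi>) ^ N"
    using growth_inv_symbol_bound[OF \<Psi> a, of ?\<tau> "DIM('a)"] by auto
  have "\<exists>B>0. \<forall>f\<in>schwartz. \<forall>l>0.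
    modular \<Psi> (\<lambda>x. ennreal (inverse l) * maximal_fun {0<..<1} (moment_order DIM('a) \<Psi>) (distr_of_fun (fourier_multiplier ?\<sigma> f)) x) \<le> 1 \<longrightarrow>
    (\<forall>x. norm (f x) \<le> B * l)"
  proof (rule multiplier_sup_bound[OF \<Psi> _ cN, where S="?S"])
    show "continuous_on UNIV ?\<sigma>"
      unfolding \<tau>
      by (rule continuous_on_compose2[OF continuous_on_growth_inv[OF \<Psi>]])
         (use a in \<open>auto intro!: continuous_intros\<close>)
    show "?S j \<in> sets borel" for j by (cases "j < 1"; cases "j = 1") auto
    show "AE \<xi> in lborel. \<exists>j. \<xi> \<in> ?S j"
    proof (intro always_eventually allI)
      fix \<xi> :: 'a
      show "\<exists>j. \<xi> \<in> ?S j"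
      proof (cases "norm \<xi> \<le> 2")
        case True
        then show ?thesis by (intro exI[of _ 1]) simp
      next
        case False
        then have "0 < norm \<xi>" by linarith
        then obtain j :: int where j: "2 powr (real_of_int j - 1) < norm \<xi>" "norm \<xi> \<le> 2 powr real_of_int j"
          by (rule dyadic_shellE)
        have "1 < j" using powr_less_cancel_iff[of 2 1 "real_of_int j"] False j(2) by simp
        then show ?thesis using j by (intro exI[of _ j]) simp
      qed
    qed
    show "growth_inv \<Psi> ((2 powr real_of_int j) ^ DIM('a) / unit_ball_vol (real DIM('a))) \<le> ?\<sigma> \<xi>" if "\<xi> \<in> ?S j" for j \<xi>
    proof (rule growth_inv_mono[OF \<Psi>])
      have "2 powr (real_of_int j - 1) \<le> sqrt (1 + (norm \<xi>)\<^sup>2)"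
      proof (cases "j = 1")
        case False
        then have "2 powr (real_of_int j - 1) \<le> norm \<xi>" using that by (auto split: if_splits)
        then show ?thesis by (rule order_trans) (auto intro: real_le_rsqrt)
      qed simp
      then have "2 ^ DIM('a) * (2 powr (real_of_int j - 1)) ^ DIM('a) \<le> 2 ^ DIM('a) * ?\<tau> \<xi>"
        unfolding \<tau> by (intro mult_left_mono power_mono) auto
      moreover have "(2 powr real_of_int j) ^ DIM('a) = 2 ^ DIM('a) * (2 powr (real_of_int j - 1)) ^ DIM('a)"
        by (simp add: powr_diff power_divide)
      ultimately have "(2 powr real_of_int j) ^ DIM('a) \<le> 2 ^ DIM('a) * ?\<tau> \<xi>" by simp
      then show "(2 powr real_of_int j) ^ DIM('a) / unit_ball_vol (real DIM('a)) \<le> a * ?\<tau> \<xi>"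
        by (simp add: a_def divide_right_mono)
    qed simp
    show "?S j \<subseteq> cball 0 (2 powr real_of_int j)" for j by auto
    show "2 powr (- real_of_int j) \<in> {0<..<1}" if "?S j \<noteq> {}" for j
    proof -
      have "1 \<le> j" using that by (auto split: if_splits)
      then show ?thesis using powr_less_mono[of "- real_of_int j" 0 "2::real"] by simp
    qed
  qed
  then obtain B where B: "B > 0" "\<And>f l. f \<in> schwartz \<Longrightarrow> l > 0 \<Longrightarrow>
    modular \<Psi> (\<lambda>x. ennreal (inverse l) * local_grand_maximal \<Psi> (distr_of_fun (bessel_operator \<Psi> a f)) x) \<le> 1 \<Longrightarrow>
    \<forall>x::'a. norm (f x) \<le> B * l"
    unfolding local_grand_maximal_def bessel_operator_def by blast
  have "Linf_norm f \<le> ennreal B * local_hardy_orlicz_norm \<Psi> (distr_of_fun (bessel_operator \<Psi> a f))" if "f \<in> schwartz" for f :: "'a \<Rightarrow> complex"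
    using Linf_norm_le_luxemburg[OF that B(1) B(2)[OF that]] B(1)
    by (auto simp: local_hardy_orlicz_norm_def ennreal_mult_top)
  then show ?thesis using B(1) by blast
qed

theorem corollary31:
  shows
    "(\<exists>a>0. \<forall>p \<Psi>. growth_function p \<Psi> \<and> real DIM('a) / (real DIM('a) + 1) < p \<and> p \<le> 1 \<longrightarrow>
        (\<exists>B>0. \<forall>f::'a::euclidean_space \<Rightarrow> complex. f \<in> schwartz \<longrightarrow>
          Linf_norm f \<le> ennreal B * hardy_orlicz_norm \<Psi> (distr_of_fun (riesz_operator \<Psi> a f))))
     \<and>
     (\<exists>a>0. \<forall>p \<Psi>. growth_function p \<Psi> \<and> real DIM('a) / (real DIM('a) + 1) < p \<and> p \<le> 1 \<longrightarrow>
        (\<exists>C>0. \<forall>f::'a::euclidean_space \<Rightarrow> complex. f \<in> schwartz \<longrightarrow>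
          Linf_norm f \<le> ennreal C * local_hardy_orlicz_norm \<Psi> (distr_of_fun (bessel_operator \<Psi> a f))))"
proof -
  have "0 < (2 ^ DIM('a) / unit_ball_vol (real DIM('a)) :: real)" by simp
  with riesz_sup_bound[where 'a='a] bessel_sup_bound[where 'a='a] show ?thesis
    by blast
qed

end
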